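(* Let $\rho>0$ and let $\mathbf g_1,\dots,\mathbf g_m:\mathbb R^n\to\mathbb R^n$ be $C^\infty$ vector fields satisfying the Chow hypothesis (so that the non-hysteretic system below is controllable). Given two points $A,B\in\mathbb R^n$ and $T>0$, consider a piecewise constant control $\bar{\mathbf u}=(\bar u_i)_{i=1}^m$ which steers the non-hysteretic system $$\dot{\mathbf z}=\sum_{i=1}^m \mathbf g_i(\mathbf z)\,\bar u_i,\qquad \mathbf z(0)=A,$$ from $A$ to $B$ in time $T$, and let $\mathbf z$ be the corresponding trajectory. For any given initial data $\mathbf w_0=(w_0^i)_{i=1}^m\in\mathbb R^m$ for the play operator, let $\mathbf v^k=(v_i^k)_{i=1}^m$ ($k$ a sufficiently large integer) be the corresponding continuous piecewise linear controls constructed explicitly from $\bar{\mathbf u}$, $\mathbf w_0$ and $\rho$ as in the context. Then the sequence of the trajectories $\mathbf z_k$ of the hysteretic systems $$\dot{\mathbf z}_k=\sum_{i=1}^m \mathbf g_i(\mathbf z_k)\,\mathcal P[v_i^k,w_0^i],\qquad \mathbf z_k(0)=A,$$ where $\mathcal P$ is the play operator of parameter $\rho$, converges uniformly on $[0,T]$, as $k\to+\infty$, to the trajectory $\mathbf z$ of the non-hysteretic system with control $\bar{\mathbf u}$.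
   Context: Play operator. Fix $\rho>0$ and $T>0$. For $u\in W^{1,1}(0,T)$ and $w_0\in\mathbb R$ with $|u(0)-w_0|\le\rho$, $w=\mathcal P[u,w_0]$ is the unique absolutely continuous function on $[0,T]$ with $w(0)=w_0$, $|u(t)-w(t)|\le\rho$ for all $t$, and $\dot w(t)\,(u(t)-w(t)-v)\ge 0$ for all $v$ with $|v|\le\rho$ and a.e. $t$. It extends to continuous inputs $u$ with $|u(0)-w_0|\le\rho$, with values in $C^0([0,T])$, and is Lipschitz continuous in the uniform norm. Chow hypothesis. At every point of $\mathbb R^n$, the vectors obtained by evaluating the iterated Lie brackets (including the fields themselves) of $\mathbf g_1,\dots,\mathbf g_m$ span $\mathbb R^n$, where $[\mathbf g_i,\mathbf g_j]=\nabla\mathbf g_j\cdot\mathbf g_i-\nabla\mathbf g_i\cdot\mathbf g_j$. Construction of $\mathbf v^k$. It is done component by component, so let $\bar u$ be one scalar component of $\bar{\mathbf u}$ and $w_0$ the corresponding component of $\mathbf w_0$. Write $\bar u=\alpha_j$ on the $j$-th interval of a subdivision $0=t_0<t_1<\dots<t_N=T$, $j=1,\dots,N$. For $k$ sufficiently large, let $u^k$ be the continuous piecewise linear function that is affine on $[0,\frac1k]$ from $w_0$ to $\alpha_1$; is affine on $[t_j-\frac1k,t_j+\frac1k]$ from $\alpha_j$ to $\alpha_{j+1}$ for $j=1,\dots,N-1$; and on the remaining intervals is constant, namely equal to $\alpha_1$ on $[\frac1k,t_1-\frac1k]$, to $\alpha_{j+1}$ on $[t_j+\frac1k,t_{j+1}-\frac1k]$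 for $j=1,\dots,N-2$, and to $\alpha_N$ on $[t_{N-1}+\frac1k,T]$ (if $N=1$, it equals $\alpha_1$ on $[\frac1k,T]$). Put $\sigma_0=\mathrm{sgn}(\alpha_1-w_0)$ and $\sigma_j=\mathrm{sgn}(\alpha_{j+1}-\alpha_j)$ for $j=1,\dots,N-1$, with $\mathrm{sgn}(0)=0$. Then $v^k$ is the continuous piecewise linear function on $[0,T]$ given by: $v^k=u^k+\sigma_0\rho$ on $[0,t_1-\frac2k]$; for $j=1,\dots,N-1$, $v^k$ is affine on $[t_j-\frac2k,t_j-\frac1k]$ from $\alpha_j+\sigma_{j-1}\rho$ to $\alpha_j+\sigma_j\rho$ (so it is constant there when $\sigma_j=\sigma_{j-1}$); $v^k=u^k+\sigma_j\rho$ on $[t_j-\frac1k,t_{j+1}-\frac2k]$ for $j=1,\dots,N-2$; and $v^k=u^k+\sigma_{N-1}\rho$ on $[t_{N-1}-\frac1k,T]$ (if $N=1$, $v^k=u^k+\sigma_0\rho$ on $[0,T]$). *)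

theory Defs
  imports "HOL-Analysis.Analysis"
begin

subsection \<open>Smooth vector fields and the Chow hypothesis\<close>

text \<open>A map is of class \<open>C\<^sup>k\<^sup>+\<^sup>1\<close> iff it is differentiable everywhere and all of its directional
  derivatives are of class \<open>C\<^sup>k\<close>.\<close>

primrec of_class_C :: "nat \<Rightarrow> ('a::real_normed_vector \<Rightarrow> 'b::real_normed_vector) \<Rightarrow> bool" where
  "of_class_C 0 f \<longleftrightarrow> continuous_on UNIV f"
| "of_class_C (Suc k) f \<longleftrightarrow>
     (\<forall>x. f differentiable at x) \<and> (\<forall>v. of_class_C k (\<lambda>x. frechet_derivative f (at x) v))"

definition smooth :: "('a::real_normed_vector \<Rightarrow> 'b::real_normed_vector) \<Rightarrow> bool" where
  "smooth f \<longleftrightarrow> (\<forall>k. of_class_C k f)"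

definition lie_bracket :: "('a::real_normed_vector \<Rightarrow> 'a) \<Rightarrow> ('a \<Rightarrow> 'a) \<Rightarrow> 'a \<Rightarrow> 'a" where
  "lie_bracket f h x = frechet_derivative h (at x) (f x) - frechet_derivative f (at x) (h x)"

inductive_set iterated_brackets :: "('i \<Rightarrow> 'a::real_normed_vector \<Rightarrow> 'a) \<Rightarrow> ('a \<Rightarrow> 'a) set"
  for g :: "'i \<Rightarrow> 'a \<Rightarrow> 'a" where
  field: "g i \<in> iterated_brackets g"
| bracket: "X \<in> iterated_brackets g \<Longrightarrow> Y \<in> iterated_brackets g
    \<Longrightarrow> lie_bracket X Y \<in> iterated_brackets g"

definition chow :: "('i \<Rightarrow> 'a::real_normed_vector \<Rightarrow> 'a) \<Rightarrow> bool" where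
  "chow g \<longleftrightarrow> (\<forall>x. span ((\<lambda>X. X x) ` iterated_brackets g) = UNIV)"

subsection \<open>Absolutely continuous functions, trajectories, play operator\<close>

definition abs_continuous_on :: "real \<Rightarrow> real \<Rightarrow> (real \<Rightarrow> 'a::real_normed_vector) \<Rightarrow> bool" where
  "abs_continuous_on a b f \<longleftrightarrow>
     (\<forall>\<epsilon>>0. \<exists>\<delta>>0. \<forall>(n::nat) p q.
        (\<forall>i<n. a \<le> p i \<and> p i \<le> q i \<and> q i \<le> b) \<longrightarrow>
        (\<forall>i<n. \<forall>j<n. i \<noteq> j \<longrightarrow> {p i<..<q i} \<inter> {p j<..<q j} = {}) \<longrightarrow>
        (\<Sum>i<n. q i - p i) < \<delta> \<longrightarrow>
        (\<Sum>i<n. norm (f (q i) - f (p i))) < \<epsilon>)"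

text \<open>Trajectories on \<open>[0,T]\<close> are understood in the sense of Caratheodory, since the control may
  be discontinuous.\<close>

definition trajectory ::
  "('m::finite \<Rightarrow> 'a::real_normed_vector \<Rightarrow> 'a) \<Rightarrow> real \<Rightarrow> 'a \<Rightarrow> (real \<Rightarrow> real ^ 'm) \<Rightarrow> (real \<Rightarrow> 'a) \<Rightarrow> bool"
  where
  "trajectory g T A c z \<longleftrightarrow>
     abs_continuous_on 0 T z \<and> z 0 = A \<and>
     (AE s in lebesgue_on {0..T}.
        (z has_vector_derivative (\<Sum>i\<in>UNIV. (c s $ i) *\<^sub>R g i (z s))) (at s within {0..T}))"

definition is_play :: "real \<Rightarrow> real \<Rightarrow> (real \<Rightarrow> real) \<Rightarrow> real \<Rightarrow> (real \<Rightarrow> real) \<Rightarrow> bool" where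
  "is_play \<rho> T u w0 w \<longleftrightarrow>
     abs_continuous_on 0 T w \<and> w 0 = w0 \<and>
     (\<forall>s\<in>{0..T}. \<bar>u s - w s\<bar> \<le> \<rho>) \<and>
     (AE s in lebesgue_on {0..T}. \<exists>d. (w has_vector_derivative d) (at s within {0..T}) \<and>
        (\<forall>x. \<bar>x\<bar> \<le> \<rho> \<longrightarrow> d * (u s - w s - x) \<ge> 0))"

text \<open>The play operator on inputs \<open>u \<in> W\<^sup>1\<^sup>,\<^sup>1(0,T)\<close> with \<open>\<bar>u 0 - w0\<bar> \<le> \<rho>\<close>; the output is a function
  on \<open>[0,T]\<close>, extended by the dummy value \<^const>\<open>undefined\<close> to make it unique as a function on the
  whole line.\<close>

definition play :: "real \<Rightarrow> real \<Rightarrow> (real \<Rightarrow> real) \<Rightarrow> real \<Rightarrow> real \<Rightarrow> real" where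
  "play \<rho> T u w0 = (THE w. w \<in> extensional {0..T} \<and> is_play \<rho> T u w0 w)"

subsection \<open>Piecewise constant controls and the modified controls\<close>

text \<open>\<open>u = \<alpha> j\<close> on the \<open>j\<close>-th interval, \<open>j = 1, \<dots>, N\<close>, of the subdivision
  \<open>0 = t 0 < \<dots> < t N = T\<close>; the values at the nodes are irrelevant.\<close>

definition piecewise_constant ::
  "real \<Rightarrow> nat \<Rightarrow> (nat \<Rightarrow> real) \<Rightarrow> (nat \<Rightarrow> real) \<Rightarrow> (real \<Rightarrow> real) \<Rightarrow> bool" where
  "piecewise_constant T N t \<alpha> u \<longleftrightarrow>
     N \<ge> 1 \<and> t 0 = 0 \<and> t N = T \<and> (\<forall>j\<in>{1..N}. t (j - 1) < t j) \<and>
     (\<forall>j\<in>{1..N}. \<forall>s\<in>{t (j - 1)<..<t j}. u s = \<alpha> j)"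

text \<open>The affine function of \<open>s\<close> with value \<open>x\<close> at \<open>a\<close> and \<open>y\<close> at \<open>b\<close>.\<close>

definition affine_from_to :: "real \<Rightarrow> real \<Rightarrow> real \<Rightarrow> real \<Rightarrow> real \<Rightarrow> real" where
  "affine_from_to a x b y s = x + (s - a) / (b - a) * (y - x)"

definition jump_sgn :: "real \<Rightarrow> (nat \<Rightarrow> real) \<Rightarrow> nat \<Rightarrow> real" where
  "jump_sgn w0 \<alpha> j = (if j = 0 then sgn (\<alpha> 1 - w0) else sgn (\<alpha> (j + 1) - \<alpha> j))"

text \<open>In the two recursions below, stage \<open>j\<close> is the construction carried out up to and including
  the node \<open>t j\<close> and continued to the right as if there were no further node; stage \<open>N - 1\<close> is the
  complete function.\<close>

primrec u_stage :: "real \<Rightarrow> (nat \<Rightarrow> real) \<Rightarrow> (nat \<Rightarrow> real) \<Rightarrow> nat \<Rightarrow> nat \<Rightarrow> real \<Rightarrow> real" where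
  "u_stage w0 t \<alpha> k 0 s =
     (if s \<le> 1 / real k then affine_from_to 0 w0 (1 / real k) (\<alpha> 1) s else \<alpha> 1)"
| "u_stage w0 t \<alpha> k (Suc j) s =
     (if s \<le> t (Suc j) - 1 / real k then u_stage w0 t \<alpha> k j s
      else if s \<le> t (Suc j) + 1 / real k
      then affine_from_to (t (Suc j) - 1 / real k) (\<alpha> (Suc j))
                          (t (Suc j) + 1 / real k) (\<alpha> (Suc (Suc j))) s
      else \<alpha> (Suc (Suc j)))"

definition u_ctrl :: "real \<Rightarrow> nat \<Rightarrow> (nat \<Rightarrow> real) \<Rightarrow> (nat \<Rightarrow> real) \<Rightarrow> nat \<Rightarrow> real \<Rightarrow> real" where
  "u_ctrl w0 N t \<alpha> k = u_stage w0 t \<alpha> k (N - 1)"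

primrec v_stage ::
  "real \<Rightarrow> real \<Rightarrow> nat \<Rightarrow> (nat \<Rightarrow> real) \<Rightarrow> (nat \<Rightarrow> real) \<Rightarrow> nat \<Rightarrow> nat \<Rightarrow> real \<Rightarrow> real" where
  "v_stage \<rho> w0 N t \<alpha> k 0 s = u_ctrl w0 N t \<alpha> k s + jump_sgn w0 \<alpha> 0 * \<rho>"
| "v_stage \<rho> w0 N t \<alpha> k (Suc j) s =
     (if s \<le> t (Suc j) - 2 / real k then v_stage \<rho> w0 N t \<alpha> k j s
      else if s \<le> t (Suc j) - 1 / real k
      then affine_from_to (t (Suc j) - 2 / real k) (\<alpha> (Suc j) + jump_sgn w0 \<alpha> j * \<rho>)
                          (t (Suc j) - 1 / real k) (\<alpha> (Suc j) + jump_sgn w0 \<alpha> (Suc j) * \<rho>) s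
      else u_ctrl w0 N t \<alpha> k s + jump_sgn w0 \<alpha> (Suc j) * \<rho>)"

definition v_ctrl ::
  "real \<Rightarrow> real \<Rightarrow> nat \<Rightarrow> (nat \<Rightarrow> real) \<Rightarrow> (nat \<Rightarrow> real) \<Rightarrow> nat \<Rightarrow> real \<Rightarrow> real" where
  "v_ctrl \<rho> w0 N t \<alpha> k = v_stage \<rho> w0 N t \<alpha> k (N - 1)"

end

theory Submission
  imports Defs
begin

text \<open>The controls \<open>v\<^sup>k\<close> are built so that \<open>u\<^sup>k\<close> itself satisfies the variational inequality of the play
  operator with input \<open>v\<^sup>k\<close>; as that inequality has at most one absolutely continuous solution,
  \<open>u\<^sup>k\<close> is the output of the play operator. The hysteretic system is therefore the non-hysteretic one with
  control \<open>u\<^sup>k\<close>. These controls are bounded uniformly in \<open>k\<close> and differ from \<open>ubar\<close> only at distance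
  less than \<open>1/k\<close> from the nodes, so Gronwall's inequality bounds \<open>\<parallel>z\<^sub>k - z\<parallel>\<^sup>2\<close> by a multiple of
  \<open>1/k\<close>. The fields are only locally Lipschitz: they are first cut off outside a ball that contains the
  unit neighbourhood of the trajectory \<open>z\<close>, and for large \<open>k\<close> the estimate shows that the trajectories of
  the cut-off system never leave this ball.\<close>

subsection \<open>Absolutely continuous functions\<close>

text \<open>The output of a play operator can move only while the input is at distance
  \<open>\<rho>\<close> from it, on the side towards which it moves. So \<open>v - u\<close> must
  equal \<open>\<rho>\<close> times the sign of the jump while \<open>u\<close> moves, whereas at
  rest any offset in [-\<rho>, \<rho>] is admissible. This is why the offset is switched on the
  plateau just before the next ramp. Across a jump the sup distance between \<open>u\<close> and
  \<open>ubar\<close> does not tend to 0; only the measure of the set where they differ does. The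
  comparison of trajectories therefore has to integrate the control error in time. Since
  trajectories and outputs are merely absolutely continuous with derivatives almost everywhere, this
  is reduced to one monotonicity statement: an absolutely continuous real function whose derivative
  is almost everywhere at most 0 does not increase. It gives the Gronwall estimate, which is used
  three times: for uniqueness of the play output, for uniqueness of trajectories and for
  convergence. No integral of the control error is formed; an explicit function \<open>H\<close>,
  whose derivative dominates the squared error, stands for it.\<close>

lemma AE_lebesgue_on_negligible:
  assumes "AE s in lebesgue_on {a..b::real}. P s"
  obtains N where "negligible N" and "\<And>s. s \<in> {a..b} \<Longrightarrow> s \<notin> N \<Longrightarrow> P s"
proof -
  have "AE s in lebesgue. s \<in> {a..b} \<longrightarrow> P s"
    using assms by (subst (asm) AE_restrict_space_iff) auto
  then obtain N where "N \<in> null_sets lebesgue" "{s. \<not> (s \<in> {a..b} \<longrightarrow> P s)} \<subseteq> N"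
    by (auto simp: eventually_ae_filter)
  then show thesis
    by (intro that[of N]) (auto simp: negligible_iff_null_sets)
qed

lemma AE_lebesgue_on_negligibleI:
  assumes "negligible N" and "\<And>s. s \<in> {a..b::real} \<Longrightarrow> s \<notin> N \<Longrightarrow> P s"
  shows "AE s in lebesgue_on {a..b}. P s"
proof -
  have "N \<in> null_sets lebesgue"
    using assms(1) by (simp add: negligible_iff_null_sets)
  then have "AE s in lebesgue. s \<in> {a..b} \<longrightarrow> P s"
    by (rule AE_I') (use assms(2) in auto)
  then show ?thesis
    by (subst AE_restrict_space_iff) auto
qed

lemma abs_continuous_onE:
  assumes "abs_continuous_on a b f" and "\<epsilon> > 0"
  obtains \<delta> where "\<delta> > 0" and "\<And>(n::nat) p q. \<forall>i<n. a \<le> p i \<and> p i \<le> q i \<and> q i \<le> b \<Longrightarrow>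
        \<forall>i<n. \<forall>j<n. i \<noteq> j \<longrightarrow> {p i<..<q i} \<inter> {p j<..<q j} = {} \<Longrightarrow>
        (\<Sum>i<n. q i - p i) < \<delta> \<Longrightarrow>
        (\<Sum>i<n. norm (f (q i) - f (p i))) < \<epsilon>"
proof (rule exE[OF assms(1)[unfolded abs_continuous_on_def, THEN spec, THEN mp, OF assms(2)]], erule conjE)
  fix \<delta>
  assume \<delta>: "\<delta> > 0" and d: "\<forall>(n::nat) p q.
        (\<forall>i<n. a \<le> p i \<and> p i \<le> q i \<and> q i \<le> b) \<longrightarrow>
        (\<forall>i<n. \<forall>j<n. i \<noteq> j \<longrightarrow> {p i<..<q i} \<inter> {p j<..<q j} = {}) \<longrightarrow>
        (\<Sum>i<n. q i - p i) < \<delta> \<longrightarrow>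
        (\<Sum>i<n. norm (f (q i) - f (p i))) < \<epsilon>"
  show thesis
    by (rule that[OF \<delta>]) (rule d[THEN spec, THEN spec, THEN spec, THEN mp, THEN mp, THEN mp])
qed

text \<open>The common closure rule: Lipschitz functions, differences, restrictions of a function to
  the interval and the weighted square in the Gronwall estimate are all controlled by increments of
  two known functions and of the identity.\<close>

lemma abs_continuous_on_dominated:
  assumes f: "abs_continuous_on a b f" and g: "abs_continuous_on a b g"
    and h: "\<And>p q. a \<le> p \<Longrightarrow> p \<le> q \<Longrightarrow> q \<le> b \<Longrightarrow>
      norm (h q - h p) \<le> C * (norm (f q - f p) + norm (g q - g p) + (q - p))"
  shows "abs_continuous_on a b h"
  unfolding abs_continuous_on_def
proof (intro allI impI)
  fix \<epsilon> :: real assume "\<epsilon> > 0"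
  \<comment> \<open>\<open>C\<close> carries no sign condition, and the tolerance is divided by it
    below; the 3 in \<open>\<eta>\<close> counts the three sums.\<close>
  define D where "D = max C 1"
  have D: "D > 0" "C \<le> D" by (auto simp: D_def)
  define \<eta> where "\<eta> = \<epsilon> / (3 * D)"
  have \<eta>: "\<eta> > 0" using D \<open>\<epsilon> > 0\<close> by (simp add: \<eta>_def)
  obtain \<delta> where \<delta>: "\<delta> > 0" and f: "\<And>(n::nat) p q. \<forall>i<n. a \<le> p i \<and> p i \<le> q i \<and> q i \<le> b \<Longrightarrow>
        \<forall>i<n. \<forall>j<n. i \<noteq> j \<longrightarrow> {p i<..<q i} \<inter> {p j<..<q j} = {} \<Longrightarrow>
        (\<Sum>i<n. q i - p i) < \<delta> \<Longrightarrow>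
        (\<Sum>i<n. norm (f (q i) - f (p i))) < \<eta>"
    by (rule abs_continuous_onE[OF f \<eta>]) (rule that)
  obtain \<delta>' where \<delta>': "\<delta>' > 0" and g: "\<And>(n::nat) p q. \<forall>i<n. a \<le> p i \<and> p i \<le> q i \<and> q i \<le> b \<Longrightarrow>
        \<forall>i<n. \<forall>j<n. i \<noteq> j \<longrightarrow> {p i<..<q i} \<inter> {p j<..<q j} = {} \<Longrightarrow>
        (\<Sum>i<n. q i - p i) < \<delta>' \<Longrightarrow>
        (\<Sum>i<n. norm (g (q i) - g (p i))) < \<eta>"
    by (rule abs_continuous_onE[OF g \<eta>]) (rule that)
  show "\<exists>\<delta>>0. \<forall>(n::nat) p q.
        (\<forall>i<n. a \<le> p i \<and> p i \<le> q i \<and> q i \<le> b) \<longrightarrow>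
        (\<forall>i<n. \<forall>j<n. i \<noteq> j \<longrightarrow> {p i<..<q i} \<inter> {p j<..<q j} = {}) \<longrightarrow>
        (\<Sum>i<n. q i - p i) < \<delta> \<longrightarrow>
        (\<Sum>i<n. norm (h (q i) - h (p i))) < \<epsilon>"
  proof (intro exI[of _ "min \<delta> (min \<delta>' \<eta>)"] conjI allI impI)
    show "0 < min \<delta> (min \<delta>' \<eta>)" using \<delta> \<delta>' \<eta> by simp
  next
    fix n :: nat and p q
    assume A: "\<forall>i<n. a \<le> p i \<and> p i \<le> q i \<and> q i \<le> b"
      "\<forall>i<n. \<forall>j<n. i \<noteq> j \<longrightarrow> {p i<..<q i} \<inter> {p j<..<q j} = {}"
      "(\<Sum>i<n. q i - p i) < min \<delta> (min \<delta>' \<eta>)"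
    have "(\<Sum>i<n. norm (h (q i) - h (p i)))
      \<le> (\<Sum>i<n. D * (norm (f (q i) - f (p i)) + norm (g (q i) - g (p i)) + (q i - p i)))"
    proof (rule sum_mono)
      fix i assume "i \<in> {..<n}"
      then have pq: "a \<le> p i" "p i \<le> q i" "q i \<le> b" using A(1) by auto
      have "norm (h (q i) - h (p i))
        \<le> C * (norm (f (q i) - f (p i)) + norm (g (q i) - g (p i)) + (q i - p i))"
        using h pq by auto
      also have "\<dots> \<le> D * (norm (f (q i) - f (p i)) + norm (g (q i) - g (p i)) + (q i - p i))"
        using D pq by (intro mult_right_mono) auto
      finally show "norm (h (q i) - h (p i))
        \<le> D * (norm (f (q i) - f (p i)) + norm (g (q i) - g (p i)) + (q i - p i))" .
    qed
    also have "\<dots> = D * ((\<Sum>i<n. norm (f (q i) - f (p i))) + (\<Sum>i<n. norm (g (q i) - g (p i)))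
      + (\<Sum>i<n. q i - p i))"
      by (simp only: sum_distrib_left[symmetric] sum.distrib)
    also have "\<dots> < D * (\<eta> + \<eta> + \<eta>)"
      using f[OF A(1,2)] g[OF A(1,2)] A(3) D
      by (intro mult_strict_left_mono add_strict_mono) auto
    also have "\<dots> = \<epsilon>" using D by (simp add: \<eta>_def)
    finally show "(\<Sum>i<n. norm (h (q i) - h (p i))) < \<epsilon>" .
  qed
qed

lemma lipschitz_imp_abs_continuous_on:
  fixes f :: "real \<Rightarrow> 'a::real_normed_vector"
  assumes "L-lipschitz_on {a..b} f"
  shows "abs_continuous_on a b f"
proof -
  have "abs_continuous_on a b (\<lambda>_. 0 :: real)"
    unfolding abs_continuous_on_def by (auto intro: exI[of _ 1])
  then show ?thesis
  proof (rule abs_continuous_on_dominated[where C = L, OF _ \<open>abs_continuous_on a b (\<lambda>_. 0)\<close>])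
    fix p q assume "a \<le> p" "p \<le> q" "q \<le> b"
    then show "norm (f q - f p) \<le> L * (norm (0 - 0::real) + norm (0 - 0::real) + (q - p))"
      using lipschitz_onD[OF assms, of q p] by (auto simp: dist_norm)
  qed
qed

lemma abs_continuous_on_diff:
  fixes f g :: "real \<Rightarrow> 'a::real_normed_vector"
  assumes f: "abs_continuous_on a b f" and g: "abs_continuous_on a b g"
  shows "abs_continuous_on a b (\<lambda>s. f s - g s)"
proof (rule abs_continuous_on_dominated[OF f g, where C = 1])
  fix p q :: real assume "p \<le> q"
  then show "norm (f q - g q - (f p - g p)) \<le> 1 * (norm (f q - f p) + norm (g q - g p) + (q - p))"
    using norm_triangle_ineq4[of "f q - f p" "g q - g p"] by (simp add: algebra_simps)
qed

lemma abs_continuous_on_imp_continuous_on: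
  assumes "abs_continuous_on a b f"
  shows "continuous_on {a..b} f"
proof (rule uniformly_continuous_imp_continuous, unfold uniformly_continuous_on_def, intro allI impI)
  fix e :: real assume "e > 0"
  obtain d where d: "d > 0" and f: "\<And>(n::nat) p q. \<forall>i<n. a \<le> p i \<and> p i \<le> q i \<and> q i \<le> b \<Longrightarrow>
        \<forall>i<n. \<forall>j<n. i \<noteq> j \<longrightarrow> {p i<..<q i} \<inter> {p j<..<q j} = {} \<Longrightarrow>
        (\<Sum>i<n. q i - p i) < d \<Longrightarrow>
        (\<Sum>i<n. norm (f (q i) - f (p i))) < e"
    by (rule abs_continuous_onE[OF assms \<open>e > 0\<close>]) (rule that)
  have f1: "norm (f q - f p) < e" if "a \<le> p" "p \<le> q" "q \<le> b" "q - p < d" for p q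
    using f[of 1 "\<lambda>_. p" "\<lambda>_. q"] that by auto
  have "dist (f y) (f x) < e" if "x \<in> {a..b}" "y \<in> {a..b}" "dist y x < d" for x y
    using f1[of x y] f1[of y x] that by (cases "x \<le> y") (auto simp: dist_norm norm_minus_commute)
  with d show "\<exists>d>0. \<forall>x\<in>{a..b}. \<forall>y\<in>{a..b}. dist y x < d \<longrightarrow> dist (f y) (f x) < e"
    by blast
qed

lemma abs_continuous_on_bounded:
  assumes "abs_continuous_on a b f"
  obtains R where "R > 0" and "\<And>s. s \<in> {a..b} \<Longrightarrow> norm (f s) \<le> R"
proof -
  have "bounded (f ` {a..b})"
    using compact_continuous_image[OF abs_continuous_on_imp_continuous_on[OF assms] compact_Icc]
    by (rule compact_imp_bounded)
  then show thesis
    using that by (auto simp: bounded_pos)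
qed

lemma abs_continuous_on_subinterval:
  assumes "abs_continuous_on a b f" and "a \<le> c" and "d \<le> b"
  shows "abs_continuous_on c d f"
  unfolding abs_continuous_on_def
proof (intro allI impI)
  fix e :: real assume "e > 0"
  obtain \<delta> where d: "\<delta> > 0" and f: "\<And>(n::nat) p q. \<forall>i<n. a \<le> p i \<and> p i \<le> q i \<and> q i \<le> b \<Longrightarrow>
        \<forall>i<n. \<forall>j<n. i \<noteq> j \<longrightarrow> {p i<..<q i} \<inter> {p j<..<q j} = {} \<Longrightarrow>
        (\<Sum>i<n. q i - p i) < \<delta> \<Longrightarrow>
        (\<Sum>i<n. norm (f (q i) - f (p i))) < e"
    by (rule abs_continuous_onE[OF assms(1) \<open>e > 0\<close>]) (rule that)
  show "\<exists>\<delta>>0. \<forall>(n::nat) p q.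
        (\<forall>i<n. c \<le> p i \<and> p i \<le> q i \<and> q i \<le> d) \<longrightarrow>
        (\<forall>i<n. \<forall>j<n. i \<noteq> j \<longrightarrow> {p i<..<q i} \<inter> {p j<..<q j} = {}) \<longrightarrow>
        (\<Sum>i<n. q i - p i) < \<delta> \<longrightarrow>
        (\<Sum>i<n. norm (f (q i) - f (p i))) < e"
    proof (intro exI[of _ \<delta>] conjI allI impI, rule d, rule f)
    fix n :: nat and p q :: "nat \<Rightarrow> real"
    assume "\<forall>i<n. c \<le> p i \<and> p i \<le> q i \<and> q i \<le> d"
    then show "\<forall>i<n. a \<le> p i \<and> p i \<le> q i \<and> q i \<le> b"
      using assms(2,3) by fastforce
  qed
qed

text \<open>Cousin's lemma with a gauge that serves two purposes: at points where the derivative is at most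
  \<open>0\<close> it enforces the increment bound with slack \<open>e\<close>; on the exceptional null set it makes the total length
  of the tagged intervals small (the indicator has integral \<open>0\<close>), so that absolute continuity applies.\<close>

lemma abs_continuous_on_endpoint_le:
  fixes h :: "real \<Rightarrow> real"
  assumes ac: "abs_continuous_on a b h"
    and ae: "AE s in lebesgue_on {a..b}.
      \<exists>d. (h has_vector_derivative d) (at s within {a..b}) \<and> d \<le> 0"
    and "a \<le> b"
  shows "h b \<le> h a"
proof (rule field_le_epsilon)
  fix e0 :: real assume "e0 > 0"
  \<comment> \<open>Intervals with good tags contribute at most \<open>e * (b - a)\<close>, those
    with exceptional tags less than \<open>e\<close>; one more \<open>e\<close> is slack.\<close>
  define e where "e = e0 / (2 + (b - a))"
  have e: "e > 0" using \<open>e0 > 0\<close> \<open>a \<le> b\<close> by (simp add: e_def)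
  obtain N where N: "negligible N" and der: "\<And>s. s \<in> {a..b} \<Longrightarrow> s \<notin> N \<Longrightarrow>
      \<exists>d. (h has_vector_derivative d) (at s within {a..b}) \<and> d \<le> 0"
    using AE_lebesgue_on_negligible[OF ae] by metis
  obtain \<delta> where \<delta>: "\<delta> > 0" and f: "\<And>(n::nat) p q. \<forall>i<n. a \<le> p i \<and> p i \<le> q i \<and> q i \<le> b \<Longrightarrow>
        \<forall>i<n. \<forall>j<n. i \<noteq> j \<longrightarrow> {p i<..<q i} \<inter> {p j<..<q j} = {} \<Longrightarrow>
        (\<Sum>i<n. q i - p i) < \<delta> \<Longrightarrow>
        (\<Sum>i<n. norm (h (q i) - h (p i))) < e"
    by (rule abs_continuous_onE[OF ac e]) (rule that)
  have "((indicator N :: real \<Rightarrow> real) has_integral 0) {a..b}"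
    using N unfolding negligible_def by (metis box_real(2))
  then obtain \<gamma>1 where g1: "gauge \<gamma>1" and small: "\<And>p. p tagged_division_of {a..b} \<Longrightarrow> \<gamma>1 fine p \<Longrightarrow>
      norm ((\<Sum>(x, K)\<in>p. measure lborel K *\<^sub>R (indicator N x :: real)) - 0) < \<delta>"
    using \<delta> by (auto dest!: has_integral_real[THEN iffD1, THEN spec, THEN mp])
  \<comment> \<open>The tag may lie anywhere in its interval, so the linear approximation is applied
    from \<open>s\<close> to each endpoint, and the two errors add up to
    \<open>e * (v - u)\<close>.\<close>
  have "\<exists>r>0. s \<notin> N \<longrightarrow> s \<in> {a..b} \<longrightarrow> (\<forall>u v. a \<le> u \<longrightarrow> u \<le> s \<longrightarrow> s \<le> v \<longrightarrow> v \<le> b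
      \<longrightarrow> dist u s < r \<longrightarrow> dist v s < r \<longrightarrow> h v - h u \<le> e * (v - u))" for s
  proof (cases "s \<notin> N \<and> s \<in> {a..b}")
    case True
    then obtain d where d: "(h has_vector_derivative d) (at s within {a..b})" "d \<le> 0"
      using der by blast
    have "\<exists>r>0. \<forall>y\<in>{a..b}. norm (y - s) < r \<longrightarrow> norm (h y - h s - (y - s) *\<^sub>R d) \<le> e * norm (y - s)"
      using d(1) e unfolding has_vector_derivative_def has_derivative_within_alt by blast
    then obtain r where r: "r > 0" and
      lin: "\<And>y. y \<in> {a..b} \<Longrightarrow> \<bar>y - s\<bar> < r \<Longrightarrow> \<bar>h y - h s - (y - s) * d\<bar> \<le> e * \<bar>y - s\<bar>"
      by (auto simp: real_norm_def)
    show ?thesis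
    proof (intro exI[of _ r] conjI impI allI r)
      fix u v assume *: "a \<le> u" "u \<le> s" "s \<le> v" "v \<le> b" "dist u s < r" "dist v s < r"
      have "h v - h s - (v - s) * d \<le> e * (v - s)" "- (h u - h s - (u - s) * d) \<le> e * (s - u)"
        using lin[of u] lin[of v] * by (auto simp: dist_real_def)
      then have "h v - h u \<le> e * (v - u) + (v - u) * d" by (simp add: algebra_simps)
      also have "\<dots> \<le> e * (v - u)" using * d(2) by (simp add: mult_nonneg_nonpos)
      finally show "h v - h u \<le> e * (v - u)" .
    qed
  qed (auto intro: exI[of _ 1])
  then obtain r where r: "\<And>s. r s > 0" and inc: "\<And>s u v. s \<notin> N \<Longrightarrow> s \<in> {a..b} \<Longrightarrow> a \<le> u \<Longrightarrow> u \<le> s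
      \<Longrightarrow> s \<le> v \<Longrightarrow> v \<le> b \<Longrightarrow> dist u s < r s \<Longrightarrow> dist v s < r s \<Longrightarrow> h v - h u \<le> e * (v - u)"
    by metis
  define \<gamma>2 where "\<gamma>2 = (\<lambda>s. ball s (r s))"
  have "gauge (\<lambda>s. \<gamma>1 s \<inter> \<gamma>2 s)"
    using g1 r by (auto simp: gauge_def \<gamma>2_def)
  then obtain P where P: "P tagged_division_of {a..b}" and "(\<lambda>s. \<gamma>1 s \<inter> \<gamma>2 s) fine P"
    using fine_division_exists_real by blast
  then have f1: "\<gamma>1 fine P" and f2: "\<gamma>2 fine P" by (auto simp: fine_Int)
  define Q where "Q = {xK \<in> P. fst xK \<in> N}"
  have "finite P" using P by blast
  then have "finite Q" by (simp add: Q_def)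
  have K: "\<exists>u v. K = {u..v} \<and> u \<le> v \<and> Inf K = u \<and> Sup K = v \<and> a \<le> u \<and> v \<le> b \<and> u \<le> x \<and> x \<le> v
     \<and> measure lborel K = v - u \<and> interior K = {u<..<v}"
    if xK: "(x, K) \<in> P" for x K
  proof -
    obtain u v where "K = cbox u v" using tagged_division_ofD(4)[OF P xK] by blast
    then have "K = {u..v}" by simp
    moreover have "x \<in> K" "K \<subseteq> {a..b}" using tagged_division_ofD(2,3)[OF P xK] by auto
    ultimately show ?thesis by (intro exI[of _ u] exI[of _ v]) auto
  qed
  have good: "(\<Sum>(x, K)\<in>P - Q. h (Sup K) - h (Inf K)) \<le> (\<Sum>(x, K)\<in>P - Q. e * (Sup K - Inf K))"
  proof (rule sum_mono, safe)
    fix x K assume xK: "(x, K) \<in> P" "(x, K) \<notin> Q"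
    obtain u v where uv: "K = {u..v}" "u \<le> v" "Inf K = u" "Sup K = v" "a \<le> u" "v \<le> b" "u \<le> x" "x \<le> v"
      using K[OF xK(1)] by blast
    have "K \<subseteq> ball x (r x)" using fineD[OF f2 xK(1)] by (simp add: \<gamma>2_def)
    moreover have "u \<in> K" "v \<in> K" using uv by auto
    ultimately have "dist u x < r x" "dist v x < r x"
      by (metis dist_commute mem_ball subsetD)+
    then show "h (Sup K) - h (Inf K) \<le> e * (Sup K - Inf K)"
      using inc[of x u v] xK uv by (auto simp: Q_def)
  qed
  also have "\<dots> \<le> (\<Sum>(x, K)\<in>P. e * (Sup K - Inf K))"
  proof (rule sum_mono2[OF \<open>finite P\<close>])
    fix y assume "y \<in> P - (P - Q)"
    then show "0 \<le> (case y of (x, K) \<Rightarrow> e * (Sup K - Inf K))"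
      using K[of "fst y" "snd y"] e by (cases y) auto
  qed auto
  also have "\<dots> = e * (\<Sum>(x, K)\<in>P. Sup K - Inf K)"
    by (simp add: sum_distrib_left split_def)
  also have "\<dots> = e * (b - a)"
    using additive_tagged_division_1[OF \<open>a \<le> b\<close> P, of "\<lambda>x. x"] by simp
  finally have good: "(\<Sum>(x, K)\<in>P - Q. h (Sup K) - h (Inf K)) \<le> e * (b - a)" .
  have bad: "(\<Sum>(x, K)\<in>Q. \<bar>h (Sup K) - h (Inf K)\<bar>) < e"
  proof -
    \<comment> \<open>Absolute continuity is formulated for families indexed by
      \<open>i < n\<close>, so the exceptional tagged intervals have to be enumerated.\<close>
    obtain \<phi> where \<phi>: "bij_betw \<phi> {..<card Q} Q"
      using ex_bij_betw_nat_finite[OF \<open>finite Q\<close>] by (auto simp: atLeast0LessThan)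
    define p where "p i = Inf (snd (\<phi> i))" for i
    define q where "q i = Sup (snd (\<phi> i))" for i
    have in_P: "(fst (\<phi> i), snd (\<phi> i)) \<in> P" if "i < card Q" for i
      using bij_betwE[OF \<phi>] that by (auto simp: Q_def)
    have "(\<Sum>i<card Q. norm (h (q i) - h (p i))) < e"
    proof (rule f)
      show "\<forall>i<card Q. a \<le> p i \<and> p i \<le> q i \<and> q i \<le> b"
        using K[OF in_P] unfolding p_def q_def by fastforce
      show "\<forall>i<card Q. \<forall>j<card Q. i \<noteq> j \<longrightarrow> {p i<..<q i} \<inter> {p j<..<q j} = {}"
      proof (intro allI impI)
        fix i j assume ij: "i < card Q" "j < card Q" "i \<noteq> j"
        then have "\<phi> i \<noteq> \<phi> j" using \<phi> by (auto simp: bij_betw_def inj_on_def)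
        then have "interior (snd (\<phi> i)) \<inter> interior (snd (\<phi> j)) = {}"
          using tagged_division_ofD(5)[OF P in_P[OF ij(1)] in_P[OF ij(2)]] by (auto simp: prod_eq_iff)
        then show "{p i<..<q i} \<inter> {p j<..<q j} = {}"
          using K[OF in_P[OF ij(1)]] K[OF in_P[OF ij(2)]] unfolding p_def q_def by auto
      qed
      have "(\<Sum>i<card Q. q i - p i) = (\<Sum>(x, K)\<in>Q. Sup K - Inf K)"
        unfolding p_def q_def split_def
        by (rule sum.reindex_bij_betw[OF \<phi>, of "\<lambda>y. Sup (snd y) - Inf (snd y)"])
      also have "\<dots> = (\<Sum>(x, K)\<in>Q. measure lborel K *\<^sub>R (indicator N x :: real))"
      proof (rule sum.cong[OF refl], safe)
        fix x K assume "(x, K) \<in> Q"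
        then have "(x, K) \<in> P" "x \<in> N" by (auto simp: Q_def)
        then show "Sup K - Inf K = measure lborel K *\<^sub>R (indicator N x :: real)" using K[of x K] by auto
      qed
      also have "\<dots> = (\<Sum>(x, K)\<in>P. measure lborel K *\<^sub>R (indicator N x :: real))"
        by (rule sum.mono_neutral_left[OF \<open>finite P\<close>]) (auto simp: Q_def indicator_def split: if_splits)
      also have "\<dots> < \<delta>" using small[OF P f1] by simp
      finally show "(\<Sum>i<card Q. q i - p i) < \<delta>" .
    qed
    then show ?thesis
      using sum.reindex_bij_betw[OF \<phi>, of "\<lambda>y. \<bar>h (Sup (snd y)) - h (Inf (snd y))\<bar>"]
      unfolding p_def q_def split_def by simp
  qed
  have "h b - h a = (\<Sum>(x, K)\<in>P. h (Sup K) - h (Inf K))"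
    using additive_tagged_division_1[OF \<open>a \<le> b\<close> P, of h] by simp
  also have "\<dots> = (\<Sum>(x, K)\<in>P - Q. h (Sup K) - h (Inf K)) + (\<Sum>(x, K)\<in>Q. h (Sup K) - h (Inf K))"
    using \<open>finite P\<close> by (intro sum.subset_diff) (auto simp: Q_def)
  also have "\<dots> \<le> e * (b - a) + e"
  proof (intro add_mono good)
    have "(\<Sum>(x, K)\<in>Q. h (Sup K) - h (Inf K)) \<le> (\<Sum>(x, K)\<in>Q. \<bar>h (Sup K) - h (Inf K)\<bar>)"
      by (intro sum_mono) auto
    then show "(\<Sum>(x, K)\<in>Q. h (Sup K) - h (Inf K)) \<le> e" using bad by linarith
  qed
  also have "\<dots> \<le> e * (2 + (b - a))" using e by (simp add: algebra_simps)
  also have "\<dots> = e0" using \<open>a \<le> b\<close> by (simp add: e_def)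
  finally show "h b \<le> h a + e0" by simp
qed

lemma abs_continuous_on_antimono:
  fixes h :: "real \<Rightarrow> real"
  assumes ac: "abs_continuous_on a b h"
    and ae: "AE s in lebesgue_on {a..b}.
      \<exists>d. (h has_vector_derivative d) (at s within {a..b}) \<and> d \<le> 0"
    and "a \<le> x" "x \<le> y" "y \<le> b"
  shows "h y \<le> h x"
proof -
  have ac': "abs_continuous_on x y h"
    using abs_continuous_on_subinterval[OF ac] assms(3-5) by simp
  have sub: "{x..y} \<subseteq> {a..b}" using assms(3-5) by auto
  obtain N where "negligible N" and der: "\<And>s. s \<in> {a..b} \<Longrightarrow> s \<notin> N \<Longrightarrow>
      \<exists>d. (h has_vector_derivative d) (at s within {a..b}) \<and> d \<le> 0"
    using AE_lebesgue_on_negligible[OF ae] by metis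
  from this(1) have "AE s in lebesgue_on {x..y}.
      \<exists>d. (h has_vector_derivative d) (at s within {x..y}) \<and> d \<le> 0"
    by (rule AE_lebesgue_on_negligibleI)
      (meson der sub has_vector_derivative_within_subset subsetD)
  from abs_continuous_on_endpoint_le[OF ac' this \<open>x \<le> y\<close>] show ?thesis .
qed

text \<open>The quantity \<open>exp (- 2 K s) * \<parallel>e s\<parallel>\<^sup>2 - 2 * H s\<close> is nonincreasing. Working with the square of the
  norm avoids its lack of differentiability at \<open>0\<close>, and the function \<open>H\<close> replaces an integral.\<close>

lemma gronwall_abs_continuous:
  fixes e :: "real \<Rightarrow> 'a::real_inner" and H :: "real \<Rightarrow> real"
  assumes e: "abs_continuous_on 0 T e" and H: "abs_continuous_on 0 T H"
    and "e 0 = 0" and K: "K \<ge> 0"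
    and ae: "AE s in lebesgue_on {0..T}. \<exists>d h.
      (e has_vector_derivative d) (at s within {0..T}) \<and>
      (H has_vector_derivative h) (at s within {0..T}) \<and>
      h \<ge> 0 \<and> inner (e s) d \<le> K * (norm (e s))\<^sup>2 + h"
    and s: "s \<in> {0..T}"
  shows "(norm (e s))\<^sup>2 \<le> 2 * exp (2 * K * s) * (H s - H 0)"
proof -
  define w where "w r = exp (- (2 * K * r)) * inner (e r) (e r) - 2 * H r" for r
  obtain R where R: "R > 0" "\<And>r. r \<in> {0..T} \<Longrightarrow> norm (e r) \<le> R"
    using abs_continuous_on_bounded[OF e] by metis
  \<comment> \<open>The constant adds three contributions: \<open>2 * K * R\<^sup>2\<close> from the
    exponential factor, \<open>2 * R\<close> from the squared norm, 2 from \<open>H\<close>.\<close>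
  have ac: "abs_continuous_on 0 T w"
  proof (rule abs_continuous_on_dominated[OF e H, where C = "2 * K * R\<^sup>2 + 2 * R + 2"])
    fix p q assume pq: "0 \<le> p" "p \<le> q" "q \<le> T"
    define E where "E = (\<lambda>r. exp (- (2 * K * r)))"
    define n where "n = (\<lambda>r. inner (e r) (e r))"
    have "E q \<le> E p" using pq K by (auto simp: E_def intro!: mult_left_mono)
    have "E p \<le> 1" using pq K by (simp add: E_def)
    have "E p - E q = E p * (1 - exp (- (2 * K * (q - p))))"
      by (simp add: E_def right_diff_distrib flip: exp_add)
    also have "\<dots> \<le> 1 * (2 * K * (q - p))"
    proof (rule mult_mono)
      show "1 - exp (- (2 * K * (q - p))) \<le> 2 * K * (q - p)"
        using exp_ge_add_one_self[of "- (2 * K * (q - p))"] by simp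
      show "0 \<le> 1 - exp (- (2 * K * (q - p)))" using pq K by simp
    qed (use \<open>E p \<le> 1\<close> in auto)
    finally have "\<bar>E q - E p\<bar> \<le> 2 * K * (q - p)" using \<open>E q \<le> E p\<close> by simp
    moreover have "\<bar>n q\<bar> \<le> R\<^sup>2"
      using R(2)[of q] pq by (simp add: n_def power2_norm_eq_inner[symmetric] power_mono)
    ultimately have 1: "\<bar>(E q - E p) * n q\<bar> \<le> 2 * K * (q - p) * R\<^sup>2"
      unfolding abs_mult by (intro mult_mono) (use pq K in auto)
    then have E1: "\<bar>(E q - E p) * n q\<bar> \<le> 2 * K * R\<^sup>2 * (q - p)" by (simp only: mult.assoc mult.commute[of "q - p"])
    have "n q - n p = inner (e q - e p) (e q + e p)"
      by (simp add: n_def inner_diff_left inner_diff_right inner_add_right inner_commute)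
    also have "\<bar>\<dots>\<bar> \<le> norm (e q - e p) * norm (e q + e p)" by (rule Cauchy_Schwarz_ineq2)
    also have "\<dots> \<le> norm (e q - e p) * (2 * R)"
      using R(2)[of q] R(2)[of p] norm_triangle_ineq[of "e q" "e p"] pq
      by (intro mult_left_mono) auto
    finally have "\<bar>E p * (n q - n p)\<bar> \<le> 1 * (norm (e q - e p) * (2 * R))"
      unfolding abs_mult by (intro mult_mono) (use \<open>E p \<le> 1\<close> in \<open>auto simp: E_def\<close>)
    then have 2: "\<bar>E p * (n q - n p)\<bar> \<le> 2 * R * norm (e q - e p)" by (simp add: mult_ac)
    have tri: "\<bar>x\<bar> \<le> A + B + 2 * \<bar>c\<bar>"
      if "x = a + b - 2 * c" "\<bar>a\<bar> \<le> A" "\<bar>b\<bar> \<le> B" for x a b c A B :: real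
      using that by linarith
    have "w q - w p = (E q - E p) * n q + E p * (n q - n p) - 2 * (H q - H p)"
      by (simp add: w_def E_def n_def algebra_simps)
    then have "norm (w q - w p) \<le> 2 * K * R\<^sup>2 * (q - p) + 2 * R * norm (e q - e p)
        + 2 * norm (H q - H p)"
      unfolding real_norm_def by (rule tri[OF _ E1 2])
    also have "\<dots> \<le> (2 * K * R\<^sup>2 + 2 * R + 2) * (q - p) + (2 * K * R\<^sup>2 + 2 * R + 2) * norm (e q - e p)
        + (2 * K * R\<^sup>2 + 2 * R + 2) * norm (H q - H p)"
      using pq K R(1) by (intro add_mono mult_right_mono) auto
    finally show "norm (w q - w p) \<le> (2 * K * R\<^sup>2 + 2 * R + 2)
        * (norm (e q - e p) + norm (H q - H p) + (q - p))"
      by (simp add: algebra_simps)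
  qed
  have wae: "AE r in lebesgue_on {0..T}.
      \<exists>d. (w has_vector_derivative d) (at r within {0..T}) \<and> d \<le> 0"
  proof -
    obtain M where M: "negligible M" and ex: "\<And>r. r \<in> {0..T} \<Longrightarrow> r \<notin> M \<Longrightarrow> \<exists>d h.
      (e has_vector_derivative d) (at r within {0..T}) \<and>
      (H has_vector_derivative h) (at r within {0..T}) \<and>
      h \<ge> 0 \<and> inner (e r) d \<le> K * (norm (e r))\<^sup>2 + h"
      using AE_lebesgue_on_negligible[OF ae] by metis
    have "\<exists>d. (w has_vector_derivative d) (at r within {0..T}) \<and> d \<le> 0"
      if "r \<in> {0..T}" "r \<notin> M" for r
    proof -
      obtain d h where d: "(e has_vector_derivative d) (at r within {0..T})"
        and h: "(H has_vector_derivative h) (at r within {0..T})" "h \<ge> 0"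
        and le: "inner (e r) d \<le> K * (norm (e r))\<^sup>2 + h"
        using ex[OF \<open>r \<in> {0..T}\<close> \<open>r \<notin> M\<close>] by blast
      define E where "E = exp (- (2 * K * r))"
      have E: "0 < E" "E \<le> 1" using K that by (auto simp: E_def)
      define D where "D = E * (2 * inner (e r) d) + (- (2 * K)) * E * inner (e r) (e r) - 2 * h"
      have "(w has_vector_derivative D) (at r within {0..T})"
        unfolding w_def D_def E_def has_vector_derivative_def
        by (rule derivative_eq_intros d[unfolded has_vector_derivative_def]
            h(1)[unfolded has_vector_derivative_def] refl)+
          (auto simp: fun_eq_iff inner_commute algebra_simps)
      moreover have "D \<le> 0"
      proof -
        have "E * inner (e r) d \<le> E * (K * (norm (e r))\<^sup>2 + h)"
          using le E by (intro mult_left_mono) auto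
        moreover have "E * h \<le> h" using E h(2) by (simp add: mult_left_le_one_le)
        ultimately show ?thesis
          by (simp add: D_def power2_norm_eq_inner[symmetric] algebra_simps)
      qed
      ultimately show ?thesis by blast
    qed
    with M show ?thesis by (rule AE_lebesgue_on_negligibleI)
  qed
  have "w s \<le> w 0"
    by (rule abs_continuous_on_antimono[OF ac wae]) (use s in auto)
  then have "exp (- (2 * K * s)) * (norm (e s))\<^sup>2 \<le> 2 * (H s - H 0)"
    using \<open>e 0 = 0\<close> by (simp add: w_def power2_norm_eq_inner)
  then have "exp (2 * K * s) * (exp (- (2 * K * s)) * (norm (e s))\<^sup>2) \<le> exp (2 * K * s) * (2 * (H s - H 0))"
    by (intro mult_left_mono) auto
  moreover have "exp (2 * K * s) * exp (- (2 * K * s)) = 1" by (simp flip: exp_add)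
  ultimately show ?thesis by (simp only: mult.assoc[symmetric])
qed

subsection \<open>The play operator\<close>

text \<open>Testing each variational inequality with the other solution gives
  \<open>(w - w') * (d - d') \<le> 0\<close> almost everywhere.\<close>

lemma is_play_unique:
  assumes w: "is_play \<rho> T u w0 w" and w': "is_play \<rho> T u w0 w'" and s: "s \<in> {0..T}"
  shows "w s = w' s"
proof -
  \<comment> \<open>With \<open>K = 0\<close> and a constant \<open>H\<close> the Gronwall bound is
    0.\<close>
  have "(norm (w s - w' s))\<^sup>2 \<le> 2 * exp (2 * 0 * s) * (0 - 0)"
  proof (rule gronwall_abs_continuous[where T = T and H = "\<lambda>_. 0"])
    show "abs_continuous_on 0 T (\<lambda>s. w s - w' s)"
      using w w' by (auto simp: is_play_def intro: abs_continuous_on_diff)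
    show "abs_continuous_on 0 T (\<lambda>_. 0 :: real)"
      by (rule lipschitz_imp_abs_continuous_on[of 0]) (auto simp: lipschitz_on_def)
    show "w 0 - w' 0 = 0" using w w' by (simp add: is_play_def)
    have bd: "\<forall>s\<in>{0..T}. \<bar>u s - w s\<bar> \<le> \<rho>" "\<forall>s\<in>{0..T}. \<bar>u s - w' s\<bar> \<le> \<rho>"
      using w w' by (auto simp: is_play_def)
    have "AE s in lebesgue_on {0..T}. \<exists>d. (w has_vector_derivative d) (at s within {0..T}) \<and>
        (\<forall>x. \<bar>x\<bar> \<le> \<rho> \<longrightarrow> d * (u s - w s - x) \<ge> 0)"
      "AE s in lebesgue_on {0..T}. \<exists>d. (w' has_vector_derivative d) (at s within {0..T}) \<and>
        (\<forall>x. \<bar>x\<bar> \<le> \<rho> \<longrightarrow> d * (u s - w' s - x) \<ge> 0)"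
      using w w' by (auto simp: is_play_def)
    with AE_space show "AE s in lebesgue_on {0..T}. \<exists>d h.
      ((\<lambda>s. w s - w' s) has_vector_derivative d) (at s within {0..T}) \<and>
      ((\<lambda>_. 0) has_vector_derivative h) (at s within {0..T}) \<and>
      h \<ge> 0 \<and> inner (w s - w' s) d \<le> 0 * (norm (w s - w' s))\<^sup>2 + h"
    proof eventually_elim
      case (elim s)
      then have s: "s \<in> {0..T}" by simp
      obtain d d' where d: "(w has_vector_derivative d) (at s within {0..T})"
        "(w' has_vector_derivative d') (at s within {0..T})"
        and var: "\<And>x. \<bar>x\<bar> \<le> \<rho> \<Longrightarrow> d * (u s - w s - x) \<ge> 0" "\<And>x. \<bar>x\<bar> \<le> \<rho> \<Longrightarrow> d' * (u s - w' s - x) \<ge> 0"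
        using elim by blast
      have "d * (u s - w s - (u s - w' s)) \<ge> 0" "d' * (u s - w' s - (u s - w s)) \<ge> 0"
        using var bd s by blast+
      then have "inner (w s - w' s) (d - d') \<le> 0" by (simp add: algebra_simps)
      then show ?case using has_vector_derivative_diff[OF d]
        by (intro exI[of _ "d - d'"] exI[of _ 0]) auto
    qed
  qed (use s in auto)
  then show ?thesis by simp
qed

text \<open>The description in \<open>play\<close> ranges over extensional functions, while an
  explicit solution is given on the whole line. Its restriction is again a solution, because
  derivatives within \<open>{0..T}\<close> see only the values there.\<close>

lemma play_eqI:
  assumes "is_play \<rho> T u w0 w" and "s \<in> {0..T}"
  shows "play \<rho> T u w0 s = w s"
proof -
  define w' where "w' = restrict w {0..T}"
  have eq: "w' r = w r" if "r \<in> {0..T}" for r using that by (simp add: w'_def)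
  have deriv: "(w' has_vector_derivative d) (at r within {0..T}) \<longleftrightarrow>
      (w has_vector_derivative d) (at r within {0..T})" if "r \<in> {0..T}" for r d
    using that eq by (intro has_vector_derivative_cong_ev always_eventually) auto
  have "abs_continuous_on 0 T w'"
  proof (rule abs_continuous_on_dominated[where C = 1])
    show "abs_continuous_on 0 T w" "abs_continuous_on 0 T w" using assms(1) by (auto simp: is_play_def)
  qed (auto simp: eq)
  moreover have "AE r in lebesgue_on {0..T}. \<exists>d. (w' has_vector_derivative d) (at r within {0..T}) \<and>
        (\<forall>x. \<bar>x\<bar> \<le> \<rho> \<longrightarrow> d * (u r - w' r - x) \<ge> 0)"
  proof -
    have "AE r in lebesgue_on {0..T}. \<exists>d. (w has_vector_derivative d) (at r within {0..T}) \<and>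
        (\<forall>x. \<bar>x\<bar> \<le> \<rho> \<longrightarrow> d * (u r - w r - x) \<ge> 0)" using assms(1) by (simp add: is_play_def)
    with AE_space show ?thesis
      by eventually_elim (auto simp: deriv eq)
  qed
  ultimately have w': "is_play \<rho> T u w0 w'"
    using assms by (auto simp: is_play_def eq)
  have "play \<rho> T u w0 = w'"
    unfolding play_def
  proof (rule the_equality)
    show "w' \<in> extensional {0..T} \<and> is_play \<rho> T u w0 w'" using w' by (simp add: w'_def)
    fix v assume v: "v \<in> extensional {0..T} \<and> is_play \<rho> T u w0 v"
    show "v = w'"
    proof (rule extensionalityI[of _ "{0..T}"])
      show "w' \<in> extensional {0..T}" by (simp add: w'_def)
    qed (use v is_play_unique[OF _ w'] in auto)
  qed
  then show ?thesis using eq assms(2) by simp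
qed

subsection \<open>Ordinary differential equations\<close>

text \<open>The class condition gives continuity of the derivative one direction at a time. Bounding
  it on the compact ball for each basis vector and summing bounds the operator norm, and the ball is
  convex.\<close>

lemma smooth_lipschitz_on_cball:
  fixes f :: "'a::euclidean_space \<Rightarrow> 'b::real_normed_vector"
  assumes "smooth f"
  obtains L where "L-lipschitz_on (cball x R) f"
proof -
  have "of_class_C (Suc 0) f" using assms unfolding smooth_def by blast
  then have diff: "\<And>x. f differentiable at x"
    and cont: "\<And>v. continuous_on UNIV (\<lambda>x. frechet_derivative f (at x) v)" by auto
  have "\<exists>B. \<forall>y\<in>cball x R. norm (frechet_derivative f (at y) v) \<le> B" for v
  proof -
    have "compact ((\<lambda>y. frechet_derivative f (at y) v) ` cball x R)"
      by (intro compact_continuous_image continuous_on_subset[OF cont]) auto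
    then show ?thesis
      using compact_imp_bounded bounded_iff by (metis (no_types, lifting) imageI)
  qed
  then obtain B where B: "\<And>v y. y \<in> cball x R \<Longrightarrow> norm (frechet_derivative f (at y) v) \<le> B v"
    by metis
  \<comment> \<open>For negative \<open>R\<close> the ball is empty and the bounds
    \<open>B b\<close> have no sign, whereas a Lipschitz constant must be nonnegative.\<close>
  have "(max 0 (\<Sum>b\<in>Basis. B b))-lipschitz_on (cball x R) f"
  proof (rule bounded_derivative_imp_lipschitz)
    fix y assume y: "y \<in> cball x R"
    have der: "(f has_derivative frechet_derivative f (at y)) (at y)"
      using diff frechet_derivative_works by blast
    then show "(f has_derivative frechet_derivative f (at y)) (at y within cball x R)"
      by (rule has_derivative_at_withinI)
    have "onorm (frechet_derivative f (at y)) \<le> (\<Sum>b\<in>Basis. norm (frechet_derivative f (at y) b))"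
      using der has_derivative_bounded_linear by (intro onorm_componentwise) blast
    also have "\<dots> \<le> (\<Sum>b\<in>Basis. B b)" by (intro sum_mono B y)
    finally show "onorm (frechet_derivative f (at y)) \<le> max 0 (\<Sum>b\<in>Basis. B b)" by simp
  qed auto
  then show thesis by (rule that)
qed

lemma has_vector_derivative_imp_lipschitz_on:
  fixes y :: "real \<Rightarrow> 'a::real_normed_vector"
  assumes "\<And>s. s \<in> {a..b} \<Longrightarrow> (y has_vector_derivative y' s) (at s within {a..b})"
    and "\<And>s. s \<in> {a..b} \<Longrightarrow> norm (y' s) \<le> B" and "0 \<le> B"
  shows "B-lipschitz_on {a..b} y"
proof (rule bounded_derivative_imp_lipschitz)
  fix s assume s: "s \<in> {a..b}"
  show "(y has_derivative (\<lambda>x. x *\<^sub>R y' s)) (at s within {a..b})"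
    using assms(1)[OF s] by (simp add: has_vector_derivative_def)
  have "onorm (\<lambda>x. x *\<^sub>R y' s) \<le> norm (y' s)"
    by (rule onorm_bound) (auto simp: mult.commute)
  also have "\<dots> \<le> B" by (rule assms(2)[OF s])
  finally show "onorm (\<lambda>x. x *\<^sub>R y' s) \<le> B" .
qed (use assms in auto)

text \<open>The iteration is carried out for \<open>\<phi> s = exp (- K s) *\<^sub>R y s\<close>: with this weight it is a contraction on
  the whole of \<open>[0,T]\<close>, and no continuation of local solutions is needed.\<close>

lemma ode_lipschitz_solution:
  fixes F :: "real \<Rightarrow> 'a::euclidean_space \<Rightarrow> 'a"
  assumes cont: "\<And>y. continuous_on {0..T} y \<Longrightarrow> continuous_on {0..T} (\<lambda>s. F s (y s))"
    and L: "L \<ge> 0"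
    and lip: "\<And>s x y. s \<in> {0..T} \<Longrightarrow> norm (F s x - F s y) \<le> L * norm (x - y)"
    and T: "T \<ge> 0"
  obtains y where "y 0 = A"
    and "\<And>s. s \<in> {0..T} \<Longrightarrow> (y has_vector_derivative F s (y s)) (at s within {0..T})"
proof -
  \<comment> \<open>The contraction factor is at most \<open>L / K\<close>, hence at most 1/2; the
    added 1 keeps \<open>K\<close> positive when \<open>L = 0\<close>.\<close>
  define K where "K = 2 * L + 1"
  have K: "K > 0" using L by (simp add: K_def)
  define f where "f = (\<lambda>(\<phi> :: real \<Rightarrow>\<^sub>C 'a) r. F r (exp (K * r) *\<^sub>R \<phi> r))"
  define I where "I = (\<lambda>\<phi> s. A + integral {0..s} (f \<phi>))"
  have cf: "continuous_on {0..T} (f \<phi>)" for \<phi>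
    unfolding f_def by (intro cont continuous_intros continuous_on_apply_bcontfun)
  have intf: "f \<phi> integrable_on {0..s}" if "s \<in> {0..T}" for \<phi> s
    using that by (intro integrable_continuous_real continuous_on_subset[OF cf]) auto
  have dI: "(I \<phi> has_vector_derivative f \<phi> s) (at s within {0..T})" if "s \<in> {0..T}" for \<phi> s
    unfolding I_def
    by (rule has_vector_derivative_eq_rhs[OF has_vector_derivative_add[OF has_vector_derivative_const
      integral_has_vector_derivative[OF cf that]]]) simp
  have cI: "continuous_on {0..T} (I \<phi>)" for \<phi>
    using dI has_vector_derivative_continuous continuous_on_eq_continuous_within by blast
  \<comment> \<open>The fixed point theorem is applied in the complete space of bounded continuous
    functions on the whole line; clamping the argument to \<open>{0..T}\<close> extends the image to
    that space.\<close>
  have "\<exists>g :: real \<Rightarrow>\<^sub>C 'a. \<forall>s. g s = exp (- (K * clamp 0 T s)) *\<^sub>R I \<phi> (clamp 0 T s)" for \<phi>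
  proof -
    have "continuous_on (cbox 0 T) (\<lambda>s. exp (- (K * s)) *\<^sub>R I \<phi> s)"
      using cI by (auto intro!: continuous_intros)
    from continuous_on_cbox_bcontfunE[OF this] show ?thesis by metis
  qed
  then obtain P :: "(real \<Rightarrow>\<^sub>C 'a) \<Rightarrow> (real \<Rightarrow>\<^sub>C 'a)"
    where P: "\<And>\<phi> s. P \<phi> s = exp (- (K * clamp 0 T s)) *\<^sub>R I \<phi> (clamp 0 T s)" by metis
  have contraction: "dist (P \<phi>) (P \<psi>) \<le> 1/2 * dist \<phi> \<psi>" for \<phi> \<psi>
  proof (rule dist_bound)
    fix s0 :: real
    define s where "s = clamp 0 T s0"
    have s: "s \<in> {0..T}" using clamp_in_interval[of 0 T s0] T by (auto simp: s_def)
    define D where "D = dist \<phi> \<psi>"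
    have exp_int: "((\<lambda>r. L * D * exp (K * r)) has_integral
        L * D * exp (K * s) / K - L * D * exp (K * 0) / K) {0..s}"
    proof (rule fundamental_theorem_of_calculus)
      fix r assume "r \<in> {0..s}"
      have "((\<lambda>r. L * D * exp (K * r) / K) has_real_derivative L * D * exp (K * r)) (at r within {0..s})"
        by (rule derivative_eq_intros refl)+ (use K in auto)
      then show "((\<lambda>r. L * D * exp (K * r) / K) has_vector_derivative L * D * exp (K * r)) (at r within {0..s})"
        by (simp add: has_real_derivative_iff_has_vector_derivative)
    qed (use s in auto)
    have "norm (I \<phi> s - I \<psi> s) = norm (integral {0..s} (\<lambda>r. f \<phi> r - f \<psi> r))"
      by (simp add: I_def Henstock_Kurzweil_Integration.integral_diff[OF intf[OF s] intf[OF s]])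
    also have "\<dots> \<le> integral {0..s} (\<lambda>r. L * D * exp (K * r))"
    proof (rule integral_norm_bound_integral)
      show "(\<lambda>r. f \<phi> r - f \<psi> r) integrable_on {0..s}" by (intro integrable_diff intf s)
      show "(\<lambda>r. L * D * exp (K * r)) integrable_on {0..s}" using exp_int by blast
      fix r assume r: "r \<in> {0..s}"
      have "norm (f \<phi> r - f \<psi> r) \<le> L * norm (exp (K * r) *\<^sub>R \<phi> r - exp (K * r) *\<^sub>R \<psi> r)"
        unfolding f_def using lip r s by auto
      also have "\<dots> = L * (exp (K * r) * dist (\<phi> r) (\<psi> r))"
        by (simp add: dist_norm flip: scaleR_diff_right)
      also have "\<dots> \<le> L * (exp (K * r) * D)"
        using L dist_bounded[of \<phi> r \<psi>] by (intro mult_left_mono) (auto simp: D_def)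
      finally show "norm (f \<phi> r - f \<psi> r) \<le> L * D * exp (K * r)" by (simp add: mult_ac)
    qed
    also have "\<dots> = L * D / K * (exp (K * s) - 1)"
      using integral_unique[OF exp_int] by (simp add: diff_divide_distrib right_diff_distrib)
    also have "\<dots> \<le> D / 2 * exp (K * s)"
    proof (rule mult_mono)
      show "L * D / K \<le> D / 2"
        using L K mult_right_mono[of "2 * L" K D] by (simp add: K_def D_def field_simps)
      show "0 \<le> exp (K * s) - 1" using s K by simp
    qed (auto simp: D_def)
    finally have "exp (- (K * s)) * norm (I \<phi> s - I \<psi> s) \<le> exp (- (K * s)) * (D / 2 * exp (K * s))"
      by (intro mult_left_mono) auto
    also have "\<dots> = D / 2" by (simp add: exp_minus field_simps)
    finally show "dist (P \<phi> s0) (P \<psi> s0) \<le> 1/2 * dist \<phi> \<psi>"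
      by (simp add: P dist_norm s_def[symmetric] D_def flip: scaleR_diff_right)
  qed
  then obtain \<phi> where \<phi>: "P \<phi> = \<phi>"
    using banach_fix_type[of "1/2" P] by auto
  have fix_eq: "exp (K * s) *\<^sub>R \<phi> s = I \<phi> s" if "s \<in> {0..T}" for s
  proof -
    have "\<phi> s = exp (- (K * s)) *\<^sub>R I \<phi> s"
      using P[of \<phi> s] \<phi> that clamp_cancel_cbox[of s 0 T] by simp
    then show ?thesis by (simp flip: exp_add)
  qed
  show thesis
  proof (rule that)
    show "I \<phi> 0 = A" by (simp add: I_def)
    fix s assume s: "s \<in> {0..T}"
    show "(I \<phi> has_vector_derivative F s (I \<phi> s)) (at s within {0..T})"
      using dI[OF s, of \<phi>] fix_eq[OF s] by (simp add: f_def)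
  qed
qed

text \<open>With a continuous control the equation has a classical solution. Its derivative is
  continuous, hence bounded on the interval, so the solution is Lipschitz and thus absolutely
  continuous.\<close>

lemma trajectory_exists:
  fixes G :: "'m::finite \<Rightarrow> 'a::euclidean_space \<Rightarrow> 'a"
  assumes lip: "\<And>i. L-lipschitz_on UNIV (G i)"
    and c: "continuous_on {0..T} c" and T: "T \<ge> 0"
  obtains y where "trajectory G T A c y"
proof -
  define F where "F = (\<lambda>s x. \<Sum>i\<in>UNIV. (c s $ i) *\<^sub>R G i x)"
  have L: "L \<ge> 0" using lip lipschitz_on_nonneg by blast
  have cG: "continuous_on UNIV (G i)" for i using lip lipschitz_on_continuous_on by blast
  have ci: "continuous_on {0..T} (\<lambda>s. c s $ i)" for i using c by (intro continuous_intros)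
  have cF: "continuous_on {0..T} (\<lambda>s. F s (y s))" if "continuous_on {0..T} y" for y
    unfolding F_def
    by (intro continuous_intros ci continuous_on_compose2[OF cG that]) auto
  obtain M where M: "M > 0" "\<And>s i. s \<in> {0..T} \<Longrightarrow> \<bar>c s $ i\<bar> \<le> M"
  proof -
    have "bounded (c ` {0..T})"
      using compact_continuous_image[OF c] compact_imp_bounded by blast
    then obtain M where "M > 0" "\<And>s. s \<in> {0..T} \<Longrightarrow> norm (c s) \<le> M" by (auto simp: bounded_pos)
    then show thesis using that component_le_norm_cart order_trans by blast
  qed
  have lipF: "norm (F s x - F s y) \<le> (real CARD('m) * (M * L)) * norm (x - y)"
    if s: "s \<in> {0..T}" for s x y
  proof -
    have "norm (F s x - F s y) = norm (\<Sum>i\<in>UNIV. (c s $ i) *\<^sub>R (G i x - G i y))"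
      by (simp add: F_def scaleR_diff_right sum_subtractf)
    also have "\<dots> \<le> (\<Sum>i\<in>(UNIV :: 'm set). M * (L * norm (x - y)))"
    proof (rule sum_norm_le)
      fix i
      show "norm ((c s $ i) *\<^sub>R (G i x - G i y)) \<le> M * (L * norm (x - y))"
        unfolding norm_scaleR using M L s lipschitz_onD[OF lip[of i], of x y]
        by (intro mult_mono) (auto simp: dist_norm)
    qed
    finally show ?thesis by (simp add: mult_ac)
  qed
  obtain y where y: "y 0 = A"
    "\<And>s. s \<in> {0..T} \<Longrightarrow> (y has_vector_derivative F s (y s)) (at s within {0..T})"
    using ode_lipschitz_solution[OF cF _ lipF T] M L by (metis mult_nonneg_nonneg of_nat_0_le_iff less_imp_le)
  have "continuous_on {0..T} y"
    using y(2) has_vector_derivative_continuous continuous_on_eq_continuous_within by blast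
  then have "bounded ((\<lambda>s. F s (y s)) ` {0..T})"
    using compact_continuous_image[OF cF] compact_imp_bounded by blast
  then obtain B where "B > 0" "\<And>s. s \<in> {0..T} \<Longrightarrow> norm (F s (y s)) \<le> B" by (auto simp: bounded_pos)
  then have "B-lipschitz_on {0..T} y"
    using y(2) by (intro has_vector_derivative_imp_lipschitz_on[where y' = "\<lambda>s. F s (y s)"]) auto
  then have "abs_continuous_on 0 T y" by (rule lipschitz_imp_abs_continuous_on)
  moreover have "AE s in lebesgue_on {0..T}. (y has_vector_derivative F s (y s)) (at s within {0..T})"
    using y(2) by (intro AE_lebesgue_on_negligibleI[of "{}"]) auto
  ultimately have "trajectory G T A c y" using y(1) by (simp add: trajectory_def F_def)
  then show thesis by (rule that)
qed

text \<open>Agreement of the fields is required only along \<open>z\<close>. This permits passing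
  between the original and the cut-off fields, in both directions, as long as the trajectory stays
  in the ball.\<close>

lemma trajectory_cong:
  assumes "\<And>s. s \<in> {0..T} \<Longrightarrow> c s = c' s" and "\<And>s i. s \<in> {0..T} \<Longrightarrow> G i (z s) = G' i (z s)"
  shows "trajectory G T A c z \<longleftrightarrow> trajectory G' T A c' z"
proof -
  have "(AE s in lebesgue_on {0..T}.
        (z has_vector_derivative (\<Sum>i\<in>UNIV. (c s $ i) *\<^sub>R G i (z s))) (at s within {0..T}))
    \<longleftrightarrow> (AE s in lebesgue_on {0..T}.
        (z has_vector_derivative (\<Sum>i\<in>UNIV. (c' s $ i) *\<^sub>R G' i (z s))) (at s within {0..T}))"
    by (intro AE_cong) (use assms in auto)
  then show ?thesis by (simp add: trajectory_def)
qed

lemma trajectory_comparison: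
  fixes G :: "'m::finite \<Rightarrow> 'a::real_inner \<Rightarrow> 'a"
  assumes lip: "\<And>i. L-lipschitz_on UNIV (G i)" and C: "\<And>i x. norm (G i x) \<le> C"
    and y: "trajectory G T A c y" and z: "trajectory G T A c' z"
    and M: "M \<ge> 0" "\<And>s i. s \<in> {0..T} \<Longrightarrow> \<bar>c s $ i\<bar> \<le> M"
    and H: "abs_continuous_on 0 T H"
    and dH: "AE s in lebesgue_on {0..T}. \<exists>h. (H has_vector_derivative h) (at s within {0..T}) \<and>
      (C * (\<Sum>i\<in>UNIV. \<bar>c s $ i - c' s $ i\<bar>))\<^sup>2 \<le> h"
    and s: "s \<in> {0..T}"
  shows "(norm (y s - z s))\<^sup>2 \<le> 2 * exp (2 * (real CARD('m) * (M * L) + 1) * s) * (H s - H 0)"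
proof (rule gronwall_abs_continuous[OF _ H _ _ _ s])
  have L: "L \<ge> 0" using lip lipschitz_on_nonneg by blast
  show "abs_continuous_on 0 T (\<lambda>s. y s - z s)" "y 0 - z 0 = 0"
    using y z by (auto simp: trajectory_def intro: abs_continuous_on_diff)
  show "0 \<le> real CARD('m) * (M * L) + 1" using M(1) L by simp
  have "AE s in lebesgue_on {0..T}.
        (y has_vector_derivative (\<Sum>i\<in>UNIV. (c s $ i) *\<^sub>R G i (y s))) (at s within {0..T})"
    "AE s in lebesgue_on {0..T}.
        (z has_vector_derivative (\<Sum>i\<in>UNIV. (c' s $ i) *\<^sub>R G i (z s))) (at s within {0..T})"
    using y z by (auto simp: trajectory_def)
  with AE_space dH show "AE s in lebesgue_on {0..T}. \<exists>d h.
      ((\<lambda>s. y s - z s) has_vector_derivative d) (at s within {0..T}) \<and>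
      (H has_vector_derivative h) (at s within {0..T}) \<and> h \<ge> 0 \<and>
      inner (y s - z s) d \<le> (real CARD('m) * (M * L) + 1) * (norm (y s - z s))\<^sup>2 + h"
  proof eventually_elim
    case (elim s)
    then have s: "s \<in> {0..T}" by simp
    obtain h where h: "(H has_vector_derivative h) (at s within {0..T})"
      "(C * (\<Sum>i\<in>UNIV. \<bar>c s $ i - c' s $ i\<bar>))\<^sup>2 \<le> h" using elim by blast
    define \<eta> where "\<eta> = C * (\<Sum>i\<in>UNIV. \<bar>c s $ i - c' s $ i\<bar>)"
    define e where "e = y s - z s"
    define d where "d = (\<Sum>i\<in>UNIV. (c s $ i) *\<^sub>R G i (y s)) - (\<Sum>i\<in>UNIV. (c' s $ i) *\<^sub>R G i (z s))"
    \<comment> \<open>Adding and subtracting the control \<open>c\<close> at the state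
      \<open>z\<close>: the first sum is Lipschitz in the error and needs a bound on
      \<open>c\<close> only, the second is the control error times bounded fields.\<close>
    have "d = (\<Sum>i\<in>UNIV. (c s $ i) *\<^sub>R (G i (y s) - G i (z s)))
        + (\<Sum>i\<in>UNIV. (c s $ i - c' s $ i) *\<^sub>R G i (z s))"
      by (simp add: d_def algebra_simps sum.distrib sum_subtractf)
    moreover have "norm (\<Sum>i\<in>UNIV. (c s $ i) *\<^sub>R (G i (y s) - G i (z s)))
        \<le> (\<Sum>i\<in>(UNIV :: 'm set). M * (L * norm e))"
    proof (rule sum_norm_le)
      fix i
      show "norm ((c s $ i) *\<^sub>R (G i (y s) - G i (z s))) \<le> M * (L * norm e)"
        unfolding norm_scaleR e_def using M L s lipschitz_onD[OF lip[of i], of "y s" "z s"]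
        by (intro mult_mono) (auto simp: dist_norm)
    qed
    moreover have "norm (\<Sum>i\<in>UNIV. (c s $ i - c' s $ i) *\<^sub>R G i (z s)) \<le> \<eta>"
      unfolding \<eta>_def sum_distrib_left
      by (rule sum_norm_le) (simp, metis C abs_ge_zero mult.commute mult_left_mono)
    ultimately have "norm d \<le> real CARD('m) * (M * L) * norm e + \<eta>"
      by (simp add: norm_triangle_le mult_ac add_mono)
    then have "norm e * norm d \<le> norm e * (real CARD('m) * (M * L) * norm e + \<eta>)"
      by (intro mult_left_mono) auto
    also have "\<dots> = real CARD('m) * (M * L) * (norm e)\<^sup>2 + norm e * \<eta>"
      by (simp add: power2_eq_square algebra_simps)
    \<comment> \<open>Young's inequality separates the error from \<open>\<eta>\<close>; it is the
      source of the \<open>+ 1\<close> in the exponent and of the square in the condition on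
      \<open>H\<close>.\<close>
    also have "\<dots> \<le> (real CARD('m) * (M * L) + 1) * (norm e)\<^sup>2 + \<eta>\<^sup>2"
    proof -
      have "2 * (norm e * \<eta>) \<le> (norm e)\<^sup>2 + \<eta>\<^sup>2" "0 \<le> (norm e)\<^sup>2 + \<eta>\<^sup>2"
        using sum_squares_bound[of "norm e" \<eta>] by (simp_all add: mult.assoc)
      then have "norm e * \<eta> \<le> (norm e)\<^sup>2 + \<eta>\<^sup>2" by linarith
      then show ?thesis by (simp add: algebra_simps)
    qed
    finally have "inner e d \<le> (real CARD('m) * (M * L) + 1) * (norm e)\<^sup>2 + h"
      using norm_cauchy_schwarz[of e d] h(2) by (simp add: \<eta>_def)
    moreover have "0 \<le> h" using h(2) by (rule order_trans[rotated]) simp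
    moreover have "((\<lambda>s. y s - z s) has_vector_derivative d) (at s within {0..T})"
      unfolding d_def using elim by (intro has_vector_derivative_diff) auto
    ultimately show ?case using h(1) unfolding e_def by blast
  qed
qed

text \<open>The cutoff composes the fields with the (nonexpansive) projection onto a ball.\<close>

lemma smooth_fields_cutoff:
  fixes g :: "'m::finite \<Rightarrow> 'a::euclidean_space \<Rightarrow> 'a"
  assumes "\<And>i. smooth (g i)" and R: "R \<ge> 0"
  obtains G L C where "\<And>i. L-lipschitz_on UNIV (G i)" and "\<And>i x. norm (G i x) \<le> C"
    and "\<And>i x. norm x \<le> R \<Longrightarrow> G i x = g i x"
proof -
  have "\<exists>L. L-lipschitz_on (cball 0 R) (g i)" for i
    using smooth_lipschitz_on_cball[OF assms(1)] by metis
  then obtain l where l: "\<And>i. (l i)-lipschitz_on (cball 0 R) (g i)" by metis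
  \<comment> \<open>The sum of the nonnegative constants serves as a common upper bound for
    them.\<close>
  define L where "L = (\<Sum>i\<in>UNIV. l i)"
  have l_nonneg: "l i \<ge> 0" for i using l lipschitz_on_nonneg by blast
  have "l i \<le> L" for i
    unfolding L_def using l_nonneg by (intro member_le_sum) auto
  then have lip: "L-lipschitz_on (cball 0 R) (g i)" for i using l lipschitz_on_le by blast
  define \<pi> :: "'a \<Rightarrow> 'a" where "\<pi> = closest_point (cball 0 R)"
  have ne: "cball 0 R \<noteq> {}" using R by simp
  have \<pi>: "\<pi> x \<in> cball 0 R" for x unfolding \<pi>_def using ne by (intro closest_point_in_set) auto
  have "1-lipschitz_on UNIV \<pi>"
    unfolding \<pi>_def using closest_point_lipschitz[OF convex_cball closed_cball ne]
    by (intro lipschitz_onI) auto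
  show thesis
  proof (rule that[of L "\<lambda>i x. g i (\<pi> x)" "(\<Sum>i\<in>UNIV. norm (g i 0)) + L * R"])
    fix i
    have "(L * 1)-lipschitz_on UNIV (g i \<circ> \<pi>)"
      by (rule lipschitz_on_compose[OF \<open>1-lipschitz_on UNIV \<pi>\<close> lipschitz_on_subset[OF lip]]) (use \<pi> in auto)
    then show "L-lipschitz_on UNIV (\<lambda>x. g i (\<pi> x))" by (simp add: o_def)
    fix x
    have "norm (g i (\<pi> x)) \<le> norm (g i 0) + norm (g i (\<pi> x) - g i 0)"
      using norm_triangle_ineq[of "g i 0" "g i (\<pi> x) - g i 0"] by simp
    also have "norm (g i (\<pi> x) - g i 0) \<le> L * norm (\<pi> x - 0)"
      using lipschitz_on_normD[OF lip \<pi>, of 0] R by auto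
    also have "\<dots> \<le> L * R"
      using \<pi>[of x] lipschitz_on_nonneg[OF lip] by (intro mult_left_mono) auto
    also have "norm (g i 0) \<le> (\<Sum>i\<in>UNIV. norm (g i 0))" by (intro member_le_sum) auto
    finally show "norm (g i (\<pi> x)) \<le> (\<Sum>i\<in>UNIV. norm (g i 0)) + L * R" by simp
  next
    fix i and x :: 'a assume "norm x \<le> R"
    then show "g i (\<pi> x) = g i x" by (simp add: \<pi>_def closest_point_self)
  qed
qed

text \<open>Both trajectories are bounded, so both solve the system cut off outside a ball
  containing them; there the comparison with equal controls and \<open>H = 0\<close>
  applies.\<close>

lemma trajectory_unique:
  fixes g :: "'m::finite \<Rightarrow> 'a::euclidean_space \<Rightarrow> 'a"
  assumes g: "\<And>i. smooth (g i)" and M: "M \<ge> 0" "\<And>s i. s \<in> {0..T} \<Longrightarrow> \<bar>c s $ i\<bar> \<le> M"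
    and y: "trajectory g T A c y" and z: "trajectory g T A c z" and s: "s \<in> {0..T}"
  shows "y s = z s"
proof -
  obtain R where R: "R > 0" "\<And>s. s \<in> {0..T} \<Longrightarrow> norm (y s) \<le> R"
    using abs_continuous_on_bounded y unfolding trajectory_def by metis
  obtain R' where R': "R' > 0" "\<And>s. s \<in> {0..T} \<Longrightarrow> norm (z s) \<le> R'"
    using abs_continuous_on_bounded z unfolding trajectory_def by metis
  obtain G L C where lip: "\<And>i. L-lipschitz_on UNIV (G i)" and C: "\<And>i x. norm (G i x) \<le> C"
    and eq: "\<And>i x. norm x \<le> max R R' \<Longrightarrow> G i x = g i x"
    using smooth_fields_cutoff[of g "max R R'"] g R(1) by (metis less_imp_le max.coboundedI1)
  have "trajectory G T A c y" "trajectory G T A c z"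
    using y z R(2) R'(2) trajectory_cong[of T c c g _ G A] eq by (simp_all add: le_max_iff_disj)
  note traj = this
  have ac: "abs_continuous_on 0 T (\<lambda>_. 0 :: real)"
    using lipschitz_imp_abs_continuous_on[OF lipschitz_on_constant] by blast
  have "(norm (y s - z s))\<^sup>2 \<le> 2 * exp (2 * (real CARD('m) * (M * L) + 1) * s) * (0 - 0)"
  proof (rule trajectory_comparison[where H = "\<lambda>_. 0", OF lip C traj M(1) _ ac])
    show "AE s in lebesgue_on {0..T}. \<exists>h. ((\<lambda>_. 0) has_vector_derivative h) (at s within {0..T}) \<and>
      (C * (\<Sum>i\<in>UNIV. \<bar>c s $ i - c s $ i\<bar>))\<^sup>2 \<le> h"
      by (intro always_eventually allI exI[of _ 0]) simp
  qed (use s M(2) in auto)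
  then show ?thesis by simp
qed

subsection \<open>The modified controls\<close>

lemma affine_from_to_slope: "affine_from_to a x b y s = x + (s - a) * ((y - x) / (b - a))"
  by (simp add: affine_from_to_def)

lemma affine_from_to_left: "affine_from_to a x b y a = x"
  by (simp add: affine_from_to_def)

lemma affine_from_to_right: "a \<noteq> b \<Longrightarrow> affine_from_to a x b y b = y"
  by (simp add: affine_from_to_def)

lemma affine_from_to_abs_le:
  assumes "a < b" "a \<le> s" "s \<le> b" "\<bar>x\<bar> \<le> M" "\<bar>y\<bar> \<le> M"
  shows "\<bar>affine_from_to a x b y s\<bar> \<le> M"
proof -
  define \<theta> where "\<theta> = (s - a) / (b - a)"
  have \<theta>: "0 \<le> \<theta>" "\<theta> \<le> 1" using assms by (auto simp: \<theta>_def)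
  have "affine_from_to a x b y s = (1 - \<theta>) * x + \<theta> * y"
    by (simp add: affine_from_to_def \<theta>_def[symmetric] algebra_simps)
  also have "\<bar>\<dots>\<bar> \<le> \<bar>(1 - \<theta>) * x\<bar> + \<bar>\<theta> * y\<bar>" by (rule abs_triangle_ineq)
  also have "\<dots> \<le> (1 - \<theta>) * M + \<theta> * M"
    unfolding abs_mult using \<theta> assms by (intro add_mono mult_mono) auto
  finally show ?thesis by (simp add: algebra_simps)
qed

lemma affine_from_to_lipschitz_on: "\<bar>(y - x) / (b - a)\<bar>-lipschitz_on S (affine_from_to a x b y)"
proof (rule lipschitz_onI)
  fix s r
  have "affine_from_to a x b y s - affine_from_to a x b y r = (y - x) / (b - a) * (s - r)"
    unfolding affine_from_to_slope by algebra
  then show "dist (affine_from_to a x b y s) (affine_from_to a x b y r) \<le> \<bar>(y - x) / (b - a)\<bar> * dist s r"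
    by (simp only: dist_real_def abs_mult)
qed simp

lemma affine_from_to_has_real_derivative:
  "(affine_from_to a x b y has_real_derivative (y - x) / (b - a)) (at s)"
  unfolding affine_from_to_slope[abs_def] by (rule derivative_eq_intros refl)+ simp

lemma ex_lipschitz_on_concat:
  fixes f g :: "real \<Rightarrow> real"
  assumes "\<exists>L. L-lipschitz_on {a..b} f" and "\<exists>L. L-lipschitz_on {b..c} g" and "f b = g b"
  shows "\<exists>L. L-lipschitz_on {a..c} (\<lambda>x. if x \<le> b then f x else g x)"
proof -
  obtain L1 L2 where "L1-lipschitz_on {a..b} f" "L2-lipschitz_on {b..c} g" using assms by blast
  then have "(max L1 L2)-lipschitz_on {a..b} f" "(max L1 L2)-lipschitz_on {b..c} g"
    by (auto intro: lipschitz_on_le)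
  from lipschitz_on_concat[OF this assms(3)] show ?thesis by blast
qed

text \<open>One scalar component with \<open>k\<close> fixed. The gap \<open>3 / real k\<close>
  makes a ramp of \<open>u\<close>, which ends at \<open>t j + 1 / real k\<close>, finish no later
  than \<open>t (Suc j) - 2 / real k\<close>, where the input begins to change its offset for the
  next jump.\<close>

locale modified_control =
  fixes \<rho> w0 T :: real and N k :: nat and t \<alpha> :: "nat \<Rightarrow> real"
  assumes \<rho>: "\<rho> \<ge> 0" and k: "k > 0" and N: "N \<ge> 1" and t0: "t 0 = 0" and tN: "t N = T"
    and gap: "\<And>j. j < N \<Longrightarrow> t j + 3 / real k \<le> t (Suc j)"
begin

abbreviation "U \<equiv> u_stage w0 t \<alpha> k"
abbreviation "V \<equiv> v_stage \<rho> w0 N t \<alpha> k"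
abbreviation "u \<equiv> u_ctrl w0 N t \<alpha> k"
abbreviation "v \<equiv> v_ctrl \<rho> w0 N t \<alpha> k"
definition \<delta> :: real where "\<delta> = 1 / real k"

text \<open>The signed height of the \<open>j\<close>-th ramp, the initial one starting from
  \<open>w0\<close>; it fixes the sign of the derivative of \<open>u\<close> there.\<close>

definition jump :: "nat \<Rightarrow> real" where
  "jump j = (if j = 0 then \<alpha> 1 - w0 else \<alpha> (Suc j) - \<alpha> j)"

lemma jump_sgn_eq: "jump_sgn w0 \<alpha> j = sgn (jump j)"
  by (simp add: jump_def jump_sgn_def)

text \<open>Folds the quotients occurring in the stage recursions into \<open>\<delta>\<close>;
  where the quotient itself is wanted, these rules are switched off.\<close>

lemma divide_k [simp]: "1 / real k = \<delta>" "2 / real k = 2 * \<delta>"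
  by (simp_all add: \<delta>_def)

lemma \<delta>_pos: "\<delta> > 0" using k by (simp add: \<delta>_def del: divide_k)

lemma gap': "j < N \<Longrightarrow> t j + 3 * \<delta> \<le> t (Suc j)"
  using gap by (simp add: \<delta>_def del: divide_k)

lemma t_le: "i \<le> j \<Longrightarrow> j \<le> N \<Longrightarrow> t i \<le> t j"
proof (induction j rule: dec_induct)
  case (step n)
  then show ?case using gap'[of n] \<delta>_pos by linarith
qed simp

lemma t_le_T: "j \<le> N \<Longrightarrow> t j \<le> T"
  using t_le[of j N] tN by simp

section \<open>The shape of \<open>u\<^sup>k\<close>\<close>

lemma stage_eq_\<alpha>: "j < N \<Longrightarrow> t j + \<delta> \<le> s \<Longrightarrow> U j s = \<alpha> (Suc j)"
  using \<delta>_pos t0 by (cases j) (auto simp: affine_from_to_right le_less)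

text \<open>Stage \<open>Suc n\<close> alters its predecessor only to the right of
  \<open>t (Suc n) - \<delta>\<close>, and the nodes increase.\<close>

lemma stage_prefix:
  "i \<le> j \<Longrightarrow> j < N \<Longrightarrow> i < j \<Longrightarrow> s \<le> t (Suc i) - \<delta> \<Longrightarrow> U j s = U i s"
proof (induction j rule: dec_induct)
  case (step n)
  have "s \<le> t (Suc n) - \<delta>" using t_le[of "Suc i" "Suc n"] step by simp
  then show ?case using step by (cases "i = n") auto
qed simp

text \<open>The alternative \<open>Suc j = N\<close>, which recurs below, reflects that the last
  plateau has no right end.\<close>

lemma u_eq_stage:
  assumes "j < N" "Suc j = N \<or> s \<le> t (Suc j) - \<delta>"
  shows "u s = U j s"
proof (cases "Suc j = N")
  case False
  then show ?thesis using stage_prefix[of j "N - 1" s] assms by (simp add: u_ctrl_def)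
qed (auto simp: u_ctrl_def)

lemma u_plateau:
  assumes "j < N" "t j + \<delta> \<le> s" "Suc j = N \<or> s \<le> t (Suc j) - \<delta>"
  shows "u s = \<alpha> (Suc j)"
  using u_eq_stage[of j s] stage_eq_\<alpha>[of j s] assms by simp

lemma u_ramp_0: "s \<le> \<delta> \<Longrightarrow> u s = affine_from_to 0 w0 \<delta> (\<alpha> 1) s"
  using u_eq_stage[of 0 s] N gap'[of 0] \<delta>_pos t0 by auto

lemma u_ramp_Suc:
  assumes "Suc j < N" "t (Suc j) - \<delta> \<le> s" "s \<le> t (Suc j) + \<delta>"
  shows "u s = affine_from_to (t (Suc j) - \<delta>) (\<alpha> (Suc j)) (t (Suc j) + \<delta>) (\<alpha> (Suc (Suc j))) s"
proof -
  have "u s = U (Suc j) s" using assms gap'[of "Suc j"] \<delta>_pos by (intro u_eq_stage) auto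
  \<comment> \<open>At the left end of the ramp the recursion still selects the earlier stage, so
    the two values must be matched.\<close>
  moreover have "U j (t (Suc j) - \<delta>) = \<alpha> (Suc j)"
    using assms gap'[of j] \<delta>_pos by (intro stage_eq_\<alpha>) auto
  ultimately show ?thesis using assms by (cases "s = t (Suc j) - \<delta>") (auto simp: affine_from_to_left)
qed

lemma u_0: "u 0 = w0"
  using u_ramp_0[of 0] \<delta>_pos by (simp add: affine_from_to_left)

text \<open>Adjacent pieces agree at the gluing points. Only the existence of a constant is
  recorded: it yields continuity and absolute continuity for fixed \<open>k\<close>, and no bound
  uniform in \<open>k\<close> is claimed.\<close>

lemma stage_lipschitz: "j < N \<Longrightarrow> \<exists>L. L-lipschitz_on {0..T} (U j)"
proof (induction j)
  case 0
  have "\<exists>L. L-lipschitz_on {0..T} (\<lambda>s. if s \<le> \<delta> then affine_from_to 0 w0 \<delta> (\<alpha> 1) s else \<alpha> 1)"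
    by (rule ex_lipschitz_on_concat)
      (use \<delta>_pos in \<open>auto simp: affine_from_to_right intro: affine_from_to_lipschitz_on lipschitz_on_constant\<close>)
  moreover have "U 0 = (\<lambda>s. if s \<le> \<delta> then affine_from_to 0 w0 \<delta> (\<alpha> 1) s else \<alpha> 1)"
    by (rule ext) simp
  ultimately show ?case by simp
next
  case (Suc j)
  have "\<exists>L. L-lipschitz_on {0..T} (\<lambda>s. if s \<le> t (Suc j) - \<delta> then U j s
      else if s \<le> t (Suc j) + \<delta>
      then affine_from_to (t (Suc j) - \<delta>) (\<alpha> (Suc j)) (t (Suc j) + \<delta>) (\<alpha> (Suc (Suc j))) s
      else \<alpha> (Suc (Suc j)))"
  proof (rule ex_lipschitz_on_concat)
    have "t (Suc j) - \<delta> \<le> T" using t_le_T[of "Suc j"] Suc.prems \<delta>_pos by simp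
    then have "{0..t (Suc j) - \<delta>} \<subseteq> {0..T}" by simp
    then show "\<exists>L. L-lipschitz_on {0..t (Suc j) - \<delta>} (U j)"
      using Suc lipschitz_on_subset Suc_lessD by blast
    show "\<exists>L. L-lipschitz_on {t (Suc j) - \<delta>..T} (\<lambda>s. if s \<le> t (Suc j) + \<delta>
      then affine_from_to (t (Suc j) - \<delta>) (\<alpha> (Suc j)) (t (Suc j) + \<delta>) (\<alpha> (Suc (Suc j))) s
      else \<alpha> (Suc (Suc j)))"
      by (rule ex_lipschitz_on_concat)
        (use \<delta>_pos in \<open>auto simp: affine_from_to_right intro: affine_from_to_lipschitz_on lipschitz_on_constant\<close>)
    show "U j (t (Suc j) - \<delta>) = (if t (Suc j) - \<delta> \<le> t (Suc j) + \<delta>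
      then affine_from_to (t (Suc j) - \<delta>) (\<alpha> (Suc j)) (t (Suc j) + \<delta>) (\<alpha> (Suc (Suc j))) (t (Suc j) - \<delta>)
      else \<alpha> (Suc (Suc j)))"
      using stage_eq_\<alpha>[of j "t (Suc j) - \<delta>"] Suc.prems gap'[of j] \<delta>_pos
      by (simp add: affine_from_to_left)
  qed
  moreover have "U (Suc j) = (\<lambda>s. if s \<le> t (Suc j) - \<delta> then U j s
      else if s \<le> t (Suc j) + \<delta>
      then affine_from_to (t (Suc j) - \<delta>) (\<alpha> (Suc j)) (t (Suc j) + \<delta>) (\<alpha> (Suc (Suc j))) s
      else \<alpha> (Suc (Suc j)))"
    by (rule ext) simp
  ultimately show ?case by simp
qed

lemma u_lipschitz: "\<exists>L. L-lipschitz_on {0..T} u"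
  using stage_lipschitz[of "N - 1"] N by (simp add: u_ctrl_def[abs_def])

text \<open>All values are convex combinations of \<open>w0\<close> and the plateau values, which
  makes the bound independent of \<open>k\<close>.\<close>

lemma stage_abs_le:
  assumes M: "\<bar>w0\<bar> \<le> M" "\<And>j. j \<in> {1..N} \<Longrightarrow> \<bar>\<alpha> j\<bar> \<le> M"
  shows "j < N \<Longrightarrow> 0 \<le> s \<Longrightarrow> \<bar>U j s\<bar> \<le> M"
  by (induction j) (use M \<delta>_pos N in \<open>auto intro!: affine_from_to_abs_le\<close>)

lemma u_abs_le:
  assumes "\<bar>w0\<bar> \<le> M" "\<And>j. j \<in> {1..N} \<Longrightarrow> \<bar>\<alpha> j\<bar> \<le> M" "0 \<le> s"
  shows "\<bar>u s\<bar> \<le> M"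
  using stage_abs_le[OF assms(1,2), of "N - 1" s] assms(3) N by (simp add: u_ctrl_def)

text \<open>The window consists of ramp \<open>j\<close>, where \<open>c\<close> is the reciprocal
  of its length (\<open>\<delta>\<close> for the first, \<open>2 * \<delta>\<close> for the others),
  and plateau \<open>j\<close>, where \<open>c = 0\<close>; the excluded point is the corner between
  them. The formula of the first ramp also holds for negative arguments, so the derivative at 0 is
  two-sided.\<close>

lemma u_has_derivative:
  assumes j: "j < N" and s: "0 \<le> s" "t j - \<delta> < s" "Suc j = N \<or> s < t (Suc j) - \<delta>" "s \<noteq> t j + \<delta>"
  shows "\<exists>c\<ge>0. (u has_real_derivative c * jump j) (at s)"
proof (cases "s < t j + \<delta>")
  case True
  show ?thesis
  proof (cases j)
    case 0
    have "(u has_real_derivative (\<alpha> 1 - w0) / (\<delta> - 0)) (at s)"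
      by (rule has_field_derivative_transform_within_open[OF affine_from_to_has_real_derivative, of "{..<\<delta>}"])
        (use True 0 t0 u_ramp_0 in auto)
    then show ?thesis using 0 by (intro exI[of _ "1 / \<delta>"]) (simp add: jump_def less_imp_le[OF \<delta>_pos])
  next
    case (Suc i)
    have "(u has_real_derivative (\<alpha> (Suc j) - \<alpha> j) / ((t j + \<delta>) - (t j - \<delta>))) (at s)"
      by (rule has_field_derivative_transform_within_open[OF affine_from_to_has_real_derivative,
            of "{t j - \<delta><..<t j + \<delta>}"])
        (use True Suc s j u_ramp_Suc[of i] in auto)
    then show ?thesis using Suc by (intro exI[of _ "1 / (2 * \<delta>)"]) (simp add: jump_def less_imp_le[OF \<delta>_pos])
  qed
next
  case False
  define S where "S = (if Suc j = N then {t j + \<delta><..} else {t j + \<delta><..<t (Suc j) - \<delta>})"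
  have "(u has_real_derivative 0) (at s)"
  proof (rule has_field_derivative_transform_within_open[of "\<lambda>_. \<alpha> (Suc j)" _ _ S])
    show "\<alpha> (Suc j) = u x" if "x \<in> S" for x
      using u_plateau[of j x] j that by (auto simp: S_def split: if_splits)
  qed (use False s in \<open>auto simp: S_def\<close>)
  then show ?thesis by (intro exI[of _ 0]) auto
qed

text \<open>Among all offsets of modulus at most \<open>\<rho>\<close>, the one with the sign of the
  jump maximizes the product with the jump.\<close>

lemma play_inequality:
  assumes "c \<ge> 0" "\<bar>x\<bar> \<le> \<rho>"
  shows "c * jump j * (jump_sgn w0 \<alpha> j * \<rho> - x) \<ge> 0"
proof -
  have "jump j * (sgn (jump j) * \<rho> - x) \<ge> 0"
    using assms by (cases "jump j" "0 :: real" rule: linorder_cases)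
      (auto intro: mult_nonpos_nonpos)
  with assms(1) show ?thesis by (simp add: jump_sgn_eq mult.assoc)
qed

lemma jump_sgn_abs_le: "\<bar>jump_sgn w0 \<alpha> j * \<rho>\<bar> \<le> \<rho>"
  using \<rho> by (simp add: jump_sgn_eq abs_mult abs_sgn_eq)

text \<open>The candidate output \<open>u\<close> is fixed to be the final one and only the input
  varies, since the induction over stages changes the input alone.\<close>

definition play_at :: "(real \<Rightarrow> real) \<Rightarrow> real \<Rightarrow> bool" where
  "play_at y s \<longleftrightarrow> (\<exists>d. (u has_real_derivative d) (at s) \<and> (\<forall>x. \<bar>x\<bar> \<le> \<rho> \<longrightarrow> d * (y s - u s - x) \<ge> 0))"

lemma play_at_shifted:
  assumes "j < N" "0 \<le> s" "t j - \<delta> < s" "Suc j = N \<or> s < t (Suc j) - \<delta>" "s \<noteq> t j + \<delta>"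
    and "y s = u s + jump_sgn w0 \<alpha> j * \<rho>"
  shows "play_at y s"
proof -
  obtain c where "c \<ge> 0" "(u has_real_derivative c * jump j) (at s)"
    using u_has_derivative[OF assms(1-5)] by blast
  then show ?thesis using play_inequality assms(6) unfolding play_at_def by auto
qed

text \<open>Up to \<open>t (Suc j) - 2 / real k\<close> the final control coincides with stage \<open>j\<close>; beyond that point
  its offset from \<open>u\<close> may have the wrong sign for the next jump.\<close>

lemma stage_play:
  "j < N \<Longrightarrow> \<exists>F. finite F \<and> (\<forall>s\<ge>0. Suc j = N \<or> s \<le> t (Suc j) - 2 / real k \<longrightarrow>
     \<bar>V j s - u s\<bar> \<le> \<rho> \<and> (s \<notin> F \<longrightarrow> play_at (V j) s))"
proof (induction j)
  case 0
  show ?case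
  proof (intro exI[of _ "{\<delta>}"] conjI allI impI)
    fix s assume s: "0 \<le> s" "Suc 0 = N \<or> s \<le> t (Suc 0) - 2 / real k"
    show "\<bar>V 0 s - u s\<bar> \<le> \<rho>" using jump_sgn_abs_le by simp
    assume "s \<notin> {\<delta>}"
    then show "play_at (V 0) s" using s 0 t0 \<delta>_pos by (intro play_at_shifted) auto
  qed simp
next
  case (Suc j)
  then obtain F where F: "finite F" "\<And>s. s \<ge> 0 \<Longrightarrow> s \<le> t (Suc j) - 2 / real k \<Longrightarrow>
     \<bar>V j s - u s\<bar> \<le> \<rho> \<and> (s \<notin> F \<longrightarrow> play_at (V j) s)" by auto
  let ?\<tau> = "t (Suc j)"
  show ?case
  \<comment> \<open>New exceptional points are the corners of \<open>u\<close> at the two ends of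
    the ramp. The corner of the input at \<open>?\<tau> - 2 * \<delta>\<close> is harmless:
    \<open>u\<close> is constant around it or covered by the previous stage.\<close>
  proof (intro exI[of _ "F \<union> {?\<tau> - \<delta>, ?\<tau> + \<delta>}"] conjI allI impI)
    fix s assume s: "0 \<le> s" "Suc (Suc j) = N \<or> s \<le> t (Suc (Suc j)) - 2 / real k"
    consider "s \<le> ?\<tau> - 2 / real k" | "?\<tau> - 2 / real k < s" "s \<le> ?\<tau> - \<delta>" | "?\<tau> - \<delta> < s"
      by linarith
    then have "\<bar>V (Suc j) s - u s\<bar> \<le> \<rho> \<and>
        (s \<notin> F \<union> {?\<tau> - \<delta>, ?\<tau> + \<delta>} \<longrightarrow> play_at (V (Suc j)) s)"
    proof cases
      case 1
      then show ?thesis using F(2)[OF s(1)] by (auto simp: play_at_def)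
    next
      case 2
      have "t j + \<delta> < s" using 2 gap'[of j] Suc.prems by simp
      then have u: "u s = \<alpha> (Suc j)" using 2 Suc.prems by (intro u_plateau) auto
      \<comment> \<open>Here \<open>u\<close> rests, so the offset itself is affine between two
        admissible values, and derivative 0 makes the variational inequality trivial.\<close>
      have "V (Suc j) s - u s = affine_from_to (?\<tau> - 2 / real k) (jump_sgn w0 \<alpha> j * \<rho>)
          (?\<tau> - \<delta>) (jump_sgn w0 \<alpha> (Suc j) * \<rho>) s"
        using 2 u by (simp add: affine_from_to_def)
      then have le: "\<bar>V (Suc j) s - u s\<bar> \<le> \<rho>"
        using 2 \<delta>_pos jump_sgn_abs_le by (auto intro!: affine_from_to_abs_le)
      have "play_at (V (Suc j)) s" if "s \<noteq> ?\<tau> - \<delta>"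
      proof -
        have "(u has_real_derivative 0) (at s)"
          by (rule has_field_derivative_transform_within_open[of "\<lambda>_. \<alpha> (Suc j)" _ _ "{t j + \<delta><..<?\<tau> - \<delta>}"])
            (use 2 that \<open>t j + \<delta> < s\<close> u_plateau[of j] Suc.prems in auto)
        then show ?thesis unfolding play_at_def by (intro exI[of _ 0]) auto
      qed
      with le show ?thesis by auto
    next
      case 3
      have V: "V (Suc j) s = u s + jump_sgn w0 \<alpha> (Suc j) * \<rho>"
        using 3 \<delta>_pos by simp
      moreover have "play_at (V (Suc j)) s" if "s \<noteq> ?\<tau> + \<delta>"
        by (rule play_at_shifted[where y = "V (Suc j)", OF Suc.prems s(1) 3 _ that V]) (use s(2) \<delta>_pos in auto)
      ultimately show ?thesis using jump_sgn_abs_le by auto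
    qed
    then show "\<bar>V (Suc j) s - u s\<bar> \<le> \<rho>"
      and "s \<notin> F \<union> {?\<tau> - \<delta>, ?\<tau> + \<delta>} \<Longrightarrow> play_at (V (Suc j)) s" by blast+
  qed (use F(1) in simp)
qed

lemma is_play_v: "is_play \<rho> T v w0 u"
proof -
  obtain F where F: "finite F" and play: "\<And>s. s \<ge> 0 \<Longrightarrow>
     \<bar>v s - u s\<bar> \<le> \<rho> \<and> (s \<notin> F \<longrightarrow> play_at v s)"
    using stage_play[of "N - 1"] N by (auto simp: v_ctrl_def)
  have "abs_continuous_on 0 T u" using u_lipschitz lipschitz_imp_abs_continuous_on by blast
  moreover have "AE s in lebesgue_on {0..T}. \<exists>d. (u has_vector_derivative d) (at s within {0..T}) \<and>
        (\<forall>x. \<bar>x\<bar> \<le> \<rho> \<longrightarrow> d * (v s - u s - x) \<ge> 0)"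
  proof (rule AE_lebesgue_on_negligibleI)
    show "negligible F" using F by (rule negligible_finite)
    fix s assume "s \<in> {0..T}" "s \<notin> F"
    then have "play_at v s" using play by auto
    then show "\<exists>d. (u has_vector_derivative d) (at s within {0..T}) \<and>
        (\<forall>x. \<bar>x\<bar> \<le> \<rho> \<longrightarrow> d * (v s - u s - x) \<ge> 0)"
      unfolding play_at_def has_real_derivative_iff_has_vector_derivative
      by (blast intro: has_vector_derivative_at_within)
  qed
  ultimately show ?thesis using play u_0 by (auto simp: is_play_def)
qed

section \<open>Distance from the piecewise constant control\<close>

lemma ex_subinterval:
  assumes "s \<in> {0..T}" "s \<notin> t ` {..N}"
  obtains j where "j < N" "t j < s" "s < t (Suc j)"
proof -
  define j where "j = (LEAST j. s < t (Suc j))"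
  have "s < t (Suc (N - 1))" using assms tN N by (auto simp: le_less)
  then have j: "s < t (Suc j)" and "j \<le> N - 1" unfolding j_def by (rule LeastI, rule Least_le)
  then have "j < N" using N by simp
  have "t j \<le> s"
  proof (cases j)
    case (Suc i)
    then show ?thesis using not_less_Least[of i "\<lambda>j. s < t (Suc j)"] by (auto simp: j_def)
  qed (use assms t0 in auto)
  moreover have "t j \<noteq> s" using assms(2) \<open>j < N\<close> by auto
  ultimately show thesis using that \<open>j < N\<close> j by simp
qed

text \<open>Off the \<open>\<delta>\<close>-neighbourhoods of the nodes both functions equal the
  same plateau value; inside, each is bounded by \<open>M\<close>. The set is expressed by a sum of
  indicators, one per node, because such a sum has a primitive that is explicit term by
  term.\<close>

lemma u_close:
  assumes pc: "piecewise_constant T N t \<alpha> b" and s: "s \<in> {0..T}" "s \<notin> t ` {..N}"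
    and M: "\<bar>w0\<bar> \<le> M" "\<And>j. j \<in> {1..N} \<Longrightarrow> \<bar>\<alpha> j\<bar> \<le> M"
  shows "\<bar>u s - b s\<bar> \<le> 2 * M * (\<Sum>j\<le>N. if \<bar>s - t j\<bar> < \<delta> then 1 else 0)"
proof -
  obtain j where j: "j < N" "t j < s" "s < t (Suc j)" using ex_subinterval[OF s] .
  have b: "b s = \<alpha> (Suc j)"
    using pc j unfolding piecewise_constant_def
    by (metis Suc_leI atLeastAtMost_iff diff_Suc_1 greaterThanLessThan_iff le_add1 plus_1_eq_Suc)
  define S :: real where "S = (\<Sum>j\<le>N. if \<bar>s - t j\<bar> < \<delta> then 1 else 0)"
  have S_ge: "(if \<bar>s - t i\<bar> < \<delta> then 1 else 0) \<le> S" if "i \<le> N" for i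
    unfolding S_def using that by (intro member_le_sum) auto
  have "M \<ge> 0" using M(1) by simp
  show ?thesis
  proof (cases "\<bar>s - t j\<bar> < \<delta> \<or> \<bar>s - t (Suc j)\<bar> < \<delta>")
    case True
    then have "1 \<le> S" using S_ge[of j] S_ge[of "Suc j"] j(1) by auto
    then have "2 * M * 1 \<le> 2 * M * S" using \<open>M \<ge> 0\<close> by (intro mult_left_mono) auto
    moreover have "\<bar>u s\<bar> \<le> M" using s by (intro u_abs_le M) auto
    moreover have "\<bar>b s\<bar> \<le> M" using M(2) j(1) by (simp add: b)
    ultimately show ?thesis unfolding S_def by linarith
  next
    case False
    then have "u s = \<alpha> (Suc j)" using j by (intro u_plateau) auto
    moreover have "0 \<le> S" unfolding S_def by (intro sum_nonneg) auto
    ultimately show ?thesis using b \<open>M \<ge> 0\<close> by (simp add: S_def[symmetric])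
  qed
qed

end

subsection \<open>Convergence\<close>

text \<open>A primitive of the indicator of the interval \<open>(- \<delta>, \<delta>)\<close>.\<close>

definition ramp :: "real \<Rightarrow> real \<Rightarrow> real" where
  "ramp \<delta> x = max 0 (min (2 * \<delta>) (x + \<delta>))"

lemma ramp_bounds: "0 \<le> \<delta> \<Longrightarrow> 0 \<le> ramp \<delta> x" "0 \<le> \<delta> \<Longrightarrow> ramp \<delta> x \<le> 2 * \<delta>"
  by (auto simp: ramp_def)

lemma ramp_lipschitz: "\<bar>ramp \<delta> x - ramp \<delta> y\<bar> \<le> \<bar>x - y\<bar>"
  by (auto simp: ramp_def max_def min_def)

lemma ramp_has_real_derivative:
  assumes "\<delta> > 0" "x \<noteq> \<delta>" "x \<noteq> - \<delta>"
  shows "(ramp \<delta> has_real_derivative (if \<bar>x\<bar> < \<delta> then 1 else 0)) (at x)"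
proof -
  consider "x < - \<delta>" | "\<bar>x\<bar> < \<delta>" | "\<delta> < x" using assms by linarith
  then show ?thesis
  proof cases
    case 1
    have "(ramp \<delta> has_real_derivative 0) (at x)"
      by (rule has_field_derivative_transform_within_open[of "\<lambda>_. 0" _ _ "{..<- \<delta>}"])
        (use 1 in \<open>auto simp: ramp_def\<close>)
    then show ?thesis using 1 by auto
  next
    case 2
    have "((\<lambda>x. x + \<delta>) has_real_derivative 1) (at x)" by (rule derivative_eq_intros refl)+ simp
    then have "(ramp \<delta> has_real_derivative 1) (at x)"
      by (rule has_field_derivative_transform_within_open[of _ _ _ "{- \<delta><..<\<delta>}"])
        (use 2 in \<open>auto simp: ramp_def\<close>)
    then show ?thesis using 2 by auto
  next
    case 3
    have "(ramp \<delta> has_real_derivative 0) (at x)"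
      by (rule has_field_derivative_transform_within_open[of "\<lambda>_. 2 * \<delta>" _ _ "{\<delta><..}"])
        (use 3 assms in \<open>auto simp: ramp_def\<close>)
    then show ?thesis using 3 assms by auto
  qed
qed

lemma eventually_modified_control:
  assumes "\<rho> > 0" and "piecewise_constant T N t \<alpha> u"
  shows "\<forall>\<^sub>F k in sequentially. modified_control \<rho> T N k t"
proof -
  have "\<forall>\<^sub>F k in sequentially. t j + 3 / real k \<le> t (Suc j)" if "j < N" for j
  proof -
    have "t (Suc j - 1) < t (Suc j)" using assms(2) that unfolding piecewise_constant_def by (metis One_nat_def Suc_le_mono atLeastAtMost_iff le0 less_eq_Suc_le)
    then have "0 < t (Suc j) - t j" by simp
    moreover have "(\<lambda>k. 3 / real k) \<longlonglongrightarrow> 0" by (rule lim_const_over_n)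
    ultimately have "\<forall>\<^sub>F k in sequentially. 3 / real k < t (Suc j) - t j" by (metis order_tendstoD(2))
    then show ?thesis by eventually_elim simp
  qed
  then have "\<forall>\<^sub>F k in sequentially. \<forall>j\<in>{..<N}. t j + 3 / real k \<le> t (Suc j)"
    by (intro eventually_ball_finite) auto
  with eventually_gt_at_top[of 0] show ?thesis
  proof eventually_elim
    case (elim k)
    then show ?case using assms by unfold_locales (auto simp: piecewise_constant_def)
  qed
qed

text \<open>The uniqueness clause makes \<open>Z k\<close> the trajectory on \<open>[0,T]\<close>
  for all large \<open>k\<close>; for the remaining indices the controls need not be meaningful and
  \<open>Z k\<close> is left open.\<close>

theorem theorem2p2:
  fixes g :: "'m::finite \<Rightarrow> real ^ 'n \<Rightarrow> real ^ 'n"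
    and A B :: "real ^ 'n"
    and \<rho> T :: real
    and ubar :: "real \<Rightarrow> real ^ 'm"
    and w0 :: "real ^ 'm"
    and z :: "real \<Rightarrow> real ^ 'n"
    and N :: "'m \<Rightarrow> nat"
    and t \<alpha> :: "'m \<Rightarrow> nat \<Rightarrow> real"
  defines "c \<equiv> \<lambda>k s. \<chi> i. play \<rho> T (v_ctrl \<rho> (w0 $ i) (N i) (t i) (\<alpha> i) k) (w0 $ i) s"
  assumes "\<rho> > 0" and "T > 0"
    and "\<And>i. smooth (g i)"
    and "chow g"
    and "\<And>i. piecewise_constant T (N i) (t i) (\<alpha> i) (\<lambda>s. ubar s $ i)"
    and "trajectory g T A ubar z" and "z T = B"
  shows "\<exists>Z :: nat \<Rightarrow> real \<Rightarrow> real ^ 'n.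
    (\<forall>\<^sub>F k in sequentially. trajectory g T A (c k) (Z k) \<and>
       (\<forall>y. trajectory g T A (c k) y \<longrightarrow> (\<forall>s\<in>{0..T}. y s = Z k s))) \<and>
    uniform_limit {0..T} Z z sequentially"
proof -
  note \<rho> = \<open>\<rho> > 0\<close> and T = \<open>T > 0\<close>
  note g = assms(4) and pc = assms(6) and z = assms(7)
  define M where "M = (\<Sum>i\<in>UNIV. \<bar>w0 $ i\<bar> + (\<Sum>j\<in>{1..N i}. \<bar>\<alpha> i j\<bar>))"
  have M_i: "\<bar>w0 $ i\<bar> + (\<Sum>j\<in>{1..N i}. \<bar>\<alpha> i j\<bar>) \<le> M" for i
    unfolding M_def by (rule member_le_sum) (auto intro!: add_nonneg_nonneg sum_nonneg)
  have M_w0: "\<bar>w0 $ i\<bar> \<le> M" for i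
  proof -
    have "0 \<le> (\<Sum>j\<in>{1..N i}. \<bar>\<alpha> i j\<bar>)" by (intro sum_nonneg) auto
    then show ?thesis using M_i[of i] by linarith
  qed
  have M_\<alpha>: "\<bar>\<alpha> i j\<bar> \<le> M" if "j \<in> {1..N i}" for i j
    using M_i[of i] member_le_sum[OF that, of "\<lambda>j. \<bar>\<alpha> i j\<bar>"] abs_ge_zero[of "w0 $ i"] by simp
  have M: "M \<ge> 0" using M_w0 abs_ge_zero order_trans by blast
  obtain R where R: "R > 0" "\<And>s. s \<in> {0..T} \<Longrightarrow> norm (z s) \<le> R"
    using abs_continuous_on_bounded z unfolding trajectory_def by metis
  obtain G L C where lip: "\<And>i. L-lipschitz_on UNIV (G i)" and C: "\<And>i x. norm (G i x) \<le> C"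
    and eq: "\<And>i x. norm x \<le> R + 1 \<Longrightarrow> G i x = g i x"
    using smooth_fields_cutoff[of g "R + 1"] g R(1) by (metis add_nonneg_nonneg less_imp_le zero_le_one)
  have C_nonneg: "C \<ge> 0" using C norm_ge_zero order_trans by blast
  have zG: "trajectory G T A ubar z"
    using z trajectory_cong[of T ubar ubar g z G A] eq R(2) by (simp add: add_increasing2)
  define u where "u = (\<lambda>k s. \<chi> i. u_ctrl (w0 $ i) (N i) (t i) (\<alpha> i) k s)"
  \<comment> \<open>The total number of nodes over all components, counted with the component they
    belong to.\<close>
  define P where "P = (\<Sum>i\<in>UNIV. real (N i) + 1)"
  have P: "P \<ge> 0" unfolding P_def by (intro sum_nonneg) auto
  \<comment> \<open>If \<open>S\<close> nodes are close, the error of the right-hand side is at most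
    \<open>C * (2 * M) * S\<close>. Since \<open>S \<le> P\<close>, its square is at most
    \<open>Q * S\<close>, which is linear in the indicators.\<close>
  define Q where "Q = (C * (2 * M))\<^sup>2 * P"
  have Q: "Q \<ge> 0" using P by (simp add: Q_def)
  define K where "K = real CARD('m) * (M * L) + 1"
  have K: "K \<ge> 0" using M lipschitz_on_nonneg[OF lip] by (simp add: K_def)
  \<comment> \<open>The 4 is the factor 2 of the Gronwall bound times the total height
    \<open>2 * \<delta>\<close> of a ramp, with \<open>\<delta> = 1 / real k\<close>.\<close>
  define b where "b = 4 * exp (2 * K * T) * Q * P"
  have "\<forall>\<^sub>F k in sequentially. \<forall>i. modified_control \<rho> T (N i) k (t i)"
    using eventually_modified_control[OF \<rho> pc] by (intro eventually_all_finite) auto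
  moreover have "(\<lambda>k. b / real k) \<longlonglongrightarrow> 0" by (rule lim_const_over_n)
  then have "\<forall>\<^sub>F k in sequentially. b / real k < 1" by (rule order_tendstoD) simp
  ultimately have "\<forall>\<^sub>F k in sequentially. \<exists>Y. trajectory g T A (c k) Y \<and>
      (\<forall>y. trajectory g T A (c k) y \<longrightarrow> (\<forall>s\<in>{0..T}. y s = Y s)) \<and>
      (\<forall>s\<in>{0..T}. (norm (Y s - z s))\<^sup>2 \<le> b / real k)"
  proof eventually_elim
    case (elim k)
    define \<delta> where "\<delta> = 1 / real k"
    have mc: "modified_control \<rho> T (N i) k (t i)" for i using elim(1) by blast
    have \<delta>: "\<delta> > 0" using modified_control.k[OF mc] by (simp add: \<delta>_def)
    have c_eq: "c k s = u k s" if "s \<in> {0..T}" for s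
      using play_eqI[OF modified_control.is_play_v[OF mc] that] by (simp add: c_def u_def vec_eq_iff)
    have u_le: "\<bar>u k s $ i\<bar> \<le> M" if "s \<in> {0..T}" for s i
    proof -
      have "\<bar>u_ctrl (w0 $ i) (N i) (t i) (\<alpha> i) k s\<bar> \<le> M"
        by (rule modified_control.u_abs_le[OF mc[of i] M_w0[of i]]) (use that M_\<alpha> in auto)
      then show ?thesis by (simp add: u_def)
    qed
    have "continuous_on {0..T} (u k)"
      unfolding u_def
    proof (rule continuous_on_vec_lambda)
      fix i
      show "continuous_on {0..T} (u_ctrl (w0 $ i) (N i) (t i) (\<alpha> i) k)"
        using modified_control.u_lipschitz[OF mc] lipschitz_on_continuous_on by blast
    qed
    then obtain Y where Y: "trajectory G T A (u k) Y"
      by (rule trajectory_exists[OF lip _ less_imp_le[OF T]])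
    define H where "H = (\<lambda>s. Q * (\<Sum>i\<in>UNIV. \<Sum>j\<le>N i. ramp \<delta> (s - t i j)))"
    have "(Q * P)-lipschitz_on {0..T} H"
    proof (rule lipschitz_onI)
      fix s r
      have "\<bar>(\<Sum>i\<in>UNIV. \<Sum>j\<le>N i. ramp \<delta> (s - t i j)) - (\<Sum>i\<in>UNIV. \<Sum>j\<le>N i. ramp \<delta> (r - t i j))\<bar>
          \<le> (\<Sum>i\<in>UNIV. \<Sum>j\<le>N i. \<bar>s - r\<bar>)"
        unfolding sum_subtractf[symmetric]
        by (intro order_trans[OF sum_abs] sum_mono order_trans[OF ramp_lipschitz]) simp
      also have "\<dots> = P * \<bar>s - r\<bar>" by (simp add: P_def sum_distrib_right add.commute)
      finally show "dist (H s) (H r) \<le> Q * P * dist s r"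
        using mult_left_mono[OF _ Q]
        unfolding H_def dist_real_def right_diff_distrib[symmetric] abs_mult abs_of_nonneg[OF Q] mult.assoc
        by blast
    qed (use P Q in simp)
    then have H_ac: "abs_continuous_on 0 T H" by (rule lipschitz_imp_abs_continuous_on)
    \<comment> \<open>At the nodes \<open>ubar\<close> is unspecified; at distance
      \<open>\<delta>\<close> from them the ramps in \<open>H\<close> have corners.\<close>
    define F where "F = (\<Union>i. \<Union>j\<le>N i. {t i j, t i j - \<delta>, t i j + \<delta>})"
    have "finite F" unfolding F_def by auto
    have H_deriv: "AE s in lebesgue_on {0..T}. \<exists>h. (H has_vector_derivative h) (at s within {0..T}) \<and>
        (C * (\<Sum>i\<in>UNIV. \<bar>u k s $ i - ubar s $ i\<bar>))\<^sup>2 \<le> h"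
    proof (rule AE_lebesgue_on_negligibleI[OF negligible_finite[OF \<open>finite F\<close>]])
      fix s assume s: "s \<in> {0..T}" "s \<notin> F"
      define S where "S = (\<Sum>i\<in>UNIV. \<Sum>j\<le>N i. if \<bar>s - t i j\<bar> < \<delta> then 1 else 0 :: real)"
      have "((\<lambda>s. ramp \<delta> (s - t i j)) has_real_derivative (if \<bar>s - t i j\<bar> < \<delta> then 1 else 0)) (at s)"
        if "j \<le> N i" for i j
      proof -
        have "s \<noteq> t i j - \<delta>" "s \<noteq> t i j + \<delta>" using s(2) that by (auto simp: F_def)
        then have "(ramp \<delta> has_real_derivative (if \<bar>s - t i j\<bar> < \<delta> then 1 else 0)) (at (s - t i j))"
          using \<delta> by (intro ramp_has_real_derivative) auto
        then have "((\<lambda>s. ramp \<delta> (s - t i j)) has_real_derivative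
            (if \<bar>s - t i j\<bar> < \<delta> then 1 else 0) * (1 - 0)) (at s)"
          by (rule DERIV_chain2) (rule derivative_eq_intros refl)+
        then show ?thesis by simp
      qed
      then have "(H has_real_derivative Q * S) (at s)"
        unfolding H_def S_def by (intro DERIV_cmult DERIV_sum) auto
      then have "(H has_vector_derivative Q * S) (at s within {0..T})"
        by (simp add: has_real_derivative_iff_has_vector_derivative has_vector_derivative_at_within)
      moreover have "(C * (\<Sum>i\<in>UNIV. \<bar>u k s $ i - ubar s $ i\<bar>))\<^sup>2 \<le> Q * S"
      proof -
        have S: "0 \<le> S" unfolding S_def by (intro sum_nonneg) auto
        have "S \<le> (\<Sum>i\<in>UNIV. \<Sum>j\<le>N i. 1)" unfolding S_def by (intro sum_mono) auto
        then have "S \<le> P" by (simp add: P_def add.commute)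
        have "\<bar>u k s $ i - ubar s $ i\<bar> \<le> 2 * M * (\<Sum>j\<le>N i. if \<bar>s - t i j\<bar> < \<delta> then 1 else 0)" for i
        proof -
          have "s \<notin> t i ` {..N i}" using s(2) by (auto simp: F_def)
          have "\<bar>u_ctrl (w0 $ i) (N i) (t i) (\<alpha> i) k s - ubar s $ i\<bar>
              \<le> 2 * M * (\<Sum>j\<le>N i. if \<bar>s - t i j\<bar> < modified_control.\<delta> k then 1 else 0)"
            by (rule modified_control.u_close[OF mc[of i] pc[of i] s(1) \<open>s \<notin> t i ` {..N i}\<close> M_w0[of i]])
              (rule M_\<alpha>)
          then show ?thesis by (simp add: u_def modified_control.\<delta>_def[OF mc] \<delta>_def)
        qed
        then have "(\<Sum>i\<in>UNIV. \<bar>u k s $ i - ubar s $ i\<bar>) \<le> 2 * M * S"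
          unfolding S_def sum_distrib_left[of "2 * M"] by (intro sum_mono) (simp add: sum_distrib_left)
        then have "(C * (\<Sum>i\<in>UNIV. \<bar>u k s $ i - ubar s $ i\<bar>))\<^sup>2 \<le> (C * (2 * M * S))\<^sup>2"
          using C_nonneg by (intro power_mono mult_left_mono mult_nonneg_nonneg sum_nonneg) auto
        also have "\<dots> = (C * (2 * M))\<^sup>2 * (S * S)" by (simp add: power2_eq_square mult_ac)
        also have "\<dots> \<le> (C * (2 * M))\<^sup>2 * (P * S)"
          using S \<open>S \<le> P\<close> by (intro mult_left_mono mult_right_mono) auto
        finally show ?thesis by (simp add: Q_def mult.assoc)
      qed
      ultimately show "\<exists>h. (H has_vector_derivative h) (at s within {0..T}) \<and>
        (C * (\<Sum>i\<in>UNIV. \<bar>u k s $ i - ubar s $ i\<bar>))\<^sup>2 \<le> h" by blast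
    qed
    have near: "(norm (Y s - z s))\<^sup>2 \<le> b / real k" if s: "s \<in> {0..T}" for s
    proof -
      \<comment> \<open>The Lipschitz constant of \<open>H\<close> does not shrink with
        \<open>k\<close>; its total growth does, because each ramp rises by at most
        \<open>2 * \<delta>\<close>.\<close>
      have "(\<Sum>i\<in>UNIV. \<Sum>j\<le>N i. ramp \<delta> (s - t i j)) \<le> (\<Sum>i\<in>UNIV. \<Sum>j\<le>N i. 2 * \<delta>)"
        using \<delta> by (intro sum_mono ramp_bounds) auto
      also have "\<dots> = P * (2 * \<delta>)" by (simp add: P_def sum_distrib_right add.commute)
      finally have "H s \<le> Q * (P * (2 * \<delta>))" unfolding H_def using Q by (rule mult_left_mono)
      moreover have "0 \<le> H 0"
        unfolding H_def using Q \<delta> by (intro mult_nonneg_nonneg sum_nonneg ramp_bounds) auto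
      ultimately have H: "H s - H 0 \<le> Q * (P * (2 * \<delta>))" by simp
      have "(norm (Y s - z s))\<^sup>2 \<le> 2 * exp (2 * K * s) * (H s - H 0)"
        unfolding K_def
        by (rule trajectory_comparison[OF lip C Y zG M _ H_ac H_deriv s]) (rule u_le)
      also have "\<dots> \<le> 2 * exp (2 * K * s) * (Q * (P * (2 * \<delta>)))" using H by (intro mult_left_mono) auto
      also have "\<dots> \<le> 2 * exp (2 * K * T) * (Q * (P * (2 * \<delta>)))"
        using Q P \<delta> K s by (intro mult_right_mono mult_left_mono) (auto intro: mult_left_mono)
      also have "\<dots> = b / real k" by (simp add: b_def \<delta>_def)
      finally show ?thesis .
    qed
    have "norm (Y s) \<le> R + 1" if s: "s \<in> {0..T}" for s
    proof -
      have "(norm (Y s - z s))\<^sup>2 \<le> 1\<^sup>2" using near[OF s] elim(2) by simp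
      then have "norm (Y s - z s) \<le> 1" by (rule power2_le_imp_le) simp
      then show ?thesis using R(2)[OF s] norm_triangle_sub[of "Y s" "z s"] by simp
    qed
    then have "trajectory g T A (c k) Y"
      using Y trajectory_cong[of T "c k" "u k" g Y G A] eq c_eq by simp
    moreover have "y s = Y s" if "trajectory g T A (c k) y" "s \<in> {0..T}" for y s
      using trajectory_unique[OF g M _ that(1) calculation that(2)] u_le c_eq by simp
    ultimately show ?case using near by blast
  qed
  \<comment> \<open>A choice over the index \<open>k\<close>; its values are constrained only for
    large \<open>k\<close>.\<close>
  then obtain Z where Z: "\<forall>\<^sub>F k in sequentially. trajectory g T A (c k) (Z k) \<and>
      (\<forall>y. trajectory g T A (c k) y \<longrightarrow> (\<forall>s\<in>{0..T}. y s = Z k s)) \<and>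
      (\<forall>s\<in>{0..T}. (norm (Z k s - z s))\<^sup>2 \<le> b / real k)"
    unfolding eventually_ex by blast
  have "uniform_limit {0..T} Z z sequentially"
  proof (rule uniform_limitI)
    fix e :: real assume e: "e > 0"
    have "(\<lambda>k. b / real k) \<longlonglongrightarrow> 0" by (rule lim_const_over_n)
    then have "\<forall>\<^sub>F k in sequentially. b / real k < e\<^sup>2" by (rule order_tendstoD) (use e in simp)
    with Z show "\<forall>\<^sub>F k in sequentially. \<forall>s\<in>{0..T}. dist (Z k s) (z s) < e"
    proof eventually_elim
      case (elim k)
      show ?case
      proof
        fix s assume "s \<in> {0..T}"
        then have "(norm (Z k s - z s))\<^sup>2 \<le> b / real k" using elim(1) by blast
        then have "(norm (Z k s - z s))\<^sup>2 < e\<^sup>2" using elim(2) by (rule le_less_trans)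
        then show "dist (Z k s) (z s) < e"
          unfolding dist_norm by (rule power2_less_imp_less) (use e in simp)
      qed
    qed
  qed
  moreover have "\<forall>\<^sub>F k in sequentially. trajectory g T A (c k) (Z k) \<and>
       (\<forall>y. trajectory g T A (c k) y \<longrightarrow> (\<forall>s\<in>{0..T}. y s = Z k s))"
    using Z by eventually_elim blast
  ultimately show ?thesis by blast
qed

end
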